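(* If $\mathcal U$ is a subalgebra of $\{\varphi(S_1,\dots,S_n):\varphi\in F^\infty\}\subset B(\mathcal F^2(\mathcal H_n))$ that is closed in the strong operator topology and contains the identity, then $\mathcal U$ is reflexive.
   Context: Fix an integer $n\ge 1$ and $\Lambda=\{1,\dots,n\}$. Let $\mathcal F$ be the set of all finite words in $\Lambda$, i.e. functions $f:\{1,\dots,k\}\to\Lambda$, $k\ge 0$, the empty word being denoted $0$. The full Fock space $\mathcal F^2(\mathcal H_n)$ is the complex Hilbert space with orthonormal basis $\{e_f: f\in\mathcal F\}$, where $e_0=1$ and $e_f=e_{f(1)}\otimes\cdots\otimes e_{f(k)}$. The product $\otimes$ is the bilinear extension of concatenation of words: $\langle \varphi\otimes\psi,e_h\rangle=\sum_{e_f\otimes e_g=e_h}\langle\varphi,e_f\rangle\langle\psi,e_g\rangle$. $\mathcal P=\mathrm{span}\{e_f:f\in\mathcal F\}$. $F^\infty$ is the set of all $g\in\mathcal F^2(\mathcal H_n)$ with $\|g\|_\infty=\sup\{\|g\otimes p\|_2: p\in\mathcal P,\ \|p\|_2\le 1\}<\infty$. For $\varphi\in F^\infty$, $\varphi(S_1,\dots,S_n)$ is the bounded operator $\psi\mapsto\varphi\otimes\psi$ on $\mathcal F^2(\mathcal H_n)$. For a Hilbert space $\mathcal H$ and $A\in B(\mathcal H)$, $\mathrm{Lat}\,A$ is the set of all closed invariant subspaces of $A$; for $\mathcal U\subset B(\mathcal H)$, $\mathrm{Lat}\,\mathcal U=\bigcap_{A\in\mathcal U}\mathrm{Lat}\,A$;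 for a collection $\mathcal S$ of subspaces, $\mathrm{Alg}\,\mathcal S=\{A\in B(\mathcal H):\mathcal S\subset\mathrm{Lat}\,A\}$. An algebra $\mathcal U\subset B(\mathcal H)$ is reflexive if $\mathcal U=\mathrm{Alg}\,\mathrm{Lat}\,\mathcal U$. *)

theory Defs
  imports "HOL-Analysis.Analysis"
begin

section \<open>The complex Hilbert space of square-summable families\<close>

typedef 'a ell2 = "{x :: 'a \<Rightarrow> complex. (\<lambda>i. (cmod (x i))\<^sup>2) summable_on UNIV}"
  by (rule exI[of _ "\<lambda>_. 0"]) simp

setup_lifting type_definition_ell2

lemma ell2_add:
  fixes x y :: "'a \<Rightarrow> complex"
  assumes "(\<lambda>i. (cmod (x i))\<^sup>2) summable_on UNIV" "(\<lambda>i. (cmod (y i))\<^sup>2) summable_on UNIV"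
  shows "(\<lambda>i. (cmod (x i + y i))\<^sup>2) summable_on UNIV"
proof (rule summable_on_comparison_test)
  show "(\<lambda>i. 2 * (cmod (x i))\<^sup>2 + 2 * (cmod (y i))\<^sup>2) summable_on UNIV"
    using assms by (intro summable_on_add summable_on_cmult_right) auto
next
  fix i
  have "(cmod (x i + y i))\<^sup>2 \<le> (cmod (x i) + cmod (y i))\<^sup>2"
    by (intro power_mono norm_triangle_ineq) auto
  also have "\<dots> \<le> 2 * (cmod (x i))\<^sup>2 + 2 * (cmod (y i))\<^sup>2"
    using sum_squares_bound[of "cmod (x i)" "cmod (y i)"] by (simp add: power2_sum)
  finally show "(cmod (x i + y i))\<^sup>2 \<le> 2 * (cmod (x i))\<^sup>2 + 2 * (cmod (y i))\<^sup>2" .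
qed auto

lemma ell2_scale:
  fixes x :: "'a \<Rightarrow> complex"
  assumes "(\<lambda>i. (cmod (x i))\<^sup>2) summable_on UNIV"
  shows "(\<lambda>i. (cmod (c * x i))\<^sup>2) summable_on UNIV"
  using summable_on_cmult_right[OF assms, of "(cmod c)\<^sup>2"]
  by (simp add: norm_mult power_mult_distrib)

lemma ell2_prod:
  fixes x y :: "'a \<Rightarrow> complex"
  assumes "(\<lambda>i. (cmod (x i))\<^sup>2) summable_on UNIV" "(\<lambda>i. (cmod (y i))\<^sup>2) summable_on UNIV"
  shows "(\<lambda>i. x i * cnj (y i)) summable_on UNIV"
proof (rule abs_summable_summable, rule summable_on_comparison_test)
  show "(\<lambda>i. (cmod (x i))\<^sup>2 + (cmod (y i))\<^sup>2) summable_on UNIV"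
    using assms by (rule summable_on_add)
next
  fix i
  have "2 * (cmod (x i) * cmod (y i)) \<le> (cmod (x i))\<^sup>2 + (cmod (y i))\<^sup>2"
    using sum_squares_bound[of "cmod (x i)" "cmod (y i)"] by simp
  moreover have "0 \<le> cmod (x i) * cmod (y i)" by simp
  ultimately show "norm (x i * cnj (y i)) \<le> (cmod (x i))\<^sup>2 + (cmod (y i))\<^sup>2"
    unfolding norm_mult complex_mod_cnj by linarith
qed auto

lift_definition scaleC :: "complex \<Rightarrow> 'a ell2 \<Rightarrow> 'a ell2" is "\<lambda>c x i. c * x i"
  by (rule ell2_scale)

lift_definition cinner :: "'a ell2 \<Rightarrow> 'a ell2 \<Rightarrow> complex"
  is "\<lambda>x y. infsum (\<lambda>i. x i * cnj (y i)) UNIV" .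

text \<open>The orthonormal basis vectors.\<close>
lift_definition ket :: "'a \<Rightarrow> 'a ell2" is "\<lambda>i j. if j = i then 1 else 0"
proof -
  fix i :: 'a
  have "(\<lambda>j. (cmod (if j = i then 1 else 0 :: complex))\<^sup>2) summable_on {i}" by simp
  then show "(\<lambda>j. (cmod (if j = i then 1 else 0 :: complex))\<^sup>2) summable_on UNIV"
    by (rule summable_on_cong_neutral[THEN iffD1, rotated -1]) auto
qed

instantiation ell2 :: (type) real_inner
begin

lift_definition zero_ell2 :: "'a ell2" is "\<lambda>_. 0" by simp

lift_definition plus_ell2 :: "'a ell2 \<Rightarrow> 'a ell2 \<Rightarrow> 'a ell2" is "\<lambda>x y i. x i + y i"
  by (rule ell2_add)

lift_definition uminus_ell2 :: "'a ell2 \<Rightarrow> 'a ell2" is "\<lambda>x i. - x i" by simp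

definition minus_ell2 :: "'a ell2 \<Rightarrow> 'a ell2 \<Rightarrow> 'a ell2" where "minus_ell2 x y = x + (- y)"

definition scaleR_ell2 :: "real \<Rightarrow> 'a ell2 \<Rightarrow> 'a ell2" where
  "scaleR_ell2 r = scaleC (complex_of_real r)"

lift_definition norm_ell2 :: "'a ell2 \<Rightarrow> real" is "\<lambda>x. sqrt (infsum (\<lambda>i. (cmod (x i))\<^sup>2) UNIV)" .

definition inner_ell2 :: "'a ell2 \<Rightarrow> 'a ell2 \<Rightarrow> real" where "inner_ell2 x y = Re (cinner x y)"

definition dist_ell2 :: "'a ell2 \<Rightarrow> 'a ell2 \<Rightarrow> real" where "dist_ell2 x y = norm (x - y)"

definition sgn_ell2 :: "'a ell2 \<Rightarrow> 'a ell2" where "sgn_ell2 x = scaleR (inverse (norm x)) x"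

definition uniformity_ell2 :: "('a ell2 \<times> 'a ell2) filter" where
  "uniformity_ell2 = (INF e\<in>{0<..}. principal {(x, y). dist x y < e})"

definition open_ell2 :: "'a ell2 set \<Rightarrow> bool" where
  "open_ell2 U = (\<forall>x\<in>U. \<forall>\<^sub>F (x', y) in uniformity. x' = x \<longrightarrow> y \<in> U)"

lemma cinner_add_left_ell2: "cinner (x + y) z = cinner x z + cinner (y :: 'a ell2) z"
  by transfer (simp add: distrib_right infsum_add ell2_prod)

lemma cinner_scaleC_left_ell2: "cinner (scaleC c x) z = c * cinner (x :: 'a ell2) z"
  by transfer (simp add: mult.assoc infsum_cmult_right')

lemma cinner_commute_ell2: "cinner y (x :: 'a ell2) = cnj (cinner x y)"
  by transfer (simp add: mult.commute flip: infsum_cnj)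

lemma cinner_self_ell2: "cinner x x = complex_of_real ((norm (x :: 'a ell2))\<^sup>2)"
proof (transfer)
  fix x :: "'a \<Rightarrow> complex"
  assume "(\<lambda>i. (cmod (x i))\<^sup>2) summable_on UNIV"
  then have "infsum (\<lambda>i. complex_of_real ((cmod (x i))\<^sup>2)) UNIV
      = complex_of_real (infsum (\<lambda>i. (cmod (x i))\<^sup>2) UNIV)"
    by (intro infsumI has_sum_of_real has_sum_infsum)
  then show "infsum (\<lambda>i. x i * cnj (x i)) UNIV
      = complex_of_real ((sqrt (infsum (\<lambda>i. (cmod (x i))\<^sup>2) UNIV))\<^sup>2)"
    by (simp add: complex_norm_square[symmetric] infsum_nonneg)
qed

lemma norm_eq_zero_ell2: "norm x = 0 \<longleftrightarrow> (x :: 'a ell2) = 0"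
proof (transfer)
  fix x :: "'a \<Rightarrow> complex"
  assume *: "(\<lambda>i. (cmod (x i))\<^sup>2) summable_on UNIV"
  show "sqrt (infsum (\<lambda>i. (cmod (x i))\<^sup>2) UNIV) = 0 \<longleftrightarrow> x = (\<lambda>_. 0)"
  proof
    assume "sqrt (infsum (\<lambda>i. (cmod (x i))\<^sup>2) UNIV) = 0"
    then have "infsum (\<lambda>i. (cmod (x i))\<^sup>2) UNIV = 0" by simp
    then have "(cmod (x i))\<^sup>2 = 0" for i
      using nonneg_infsum_le_0D[of "\<lambda>i. (cmod (x i))\<^sup>2" UNIV i] * by simp
    then show "x = (\<lambda>_. 0)" by auto
  qed simp
qed

instance
proof
  fix x y z :: "'a ell2" and a b :: real
  show "x + y + z = x + (y + z)" by transfer (simp add: add.assoc)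
  show "x + y = y + x" by transfer (simp add: add.commute)
  show "0 + x = x" by transfer simp
  show "- x + x = 0" by transfer simp
  show "x - y = x + - y" by (simp add: minus_ell2_def)
  show "a *\<^sub>R (x + y) = a *\<^sub>R x + a *\<^sub>R y"
    unfolding scaleR_ell2_def by transfer (simp add: distrib_left)
  show "(a + b) *\<^sub>R x = a *\<^sub>R x + b *\<^sub>R x"
    unfolding scaleR_ell2_def by transfer (simp add: distrib_right)
  show "a *\<^sub>R b *\<^sub>R x = (a * b) *\<^sub>R x"
    unfolding scaleR_ell2_def by transfer (simp add: mult.assoc)
  show "1 *\<^sub>R x = x" unfolding scaleR_ell2_def by transfer simp
  show "sgn x = scaleR (inverse (norm x)) x" by (rule sgn_ell2_def)
  show "dist x y = norm (x - y)" by (rule dist_ell2_def)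
  show "inner x y = inner y x"
    unfolding inner_ell2_def using cinner_commute_ell2[of x y] by simp
  show "inner (x + y) z = inner x z + inner y z"
    by (simp add: inner_ell2_def cinner_add_left_ell2)
  show "inner (a *\<^sub>R x) y = a * inner x y"
    by (simp add: inner_ell2_def scaleR_ell2_def cinner_scaleC_left_ell2)
  show "0 \<le> inner x x" by (simp add: inner_ell2_def cinner_self_ell2)
  show "inner x x = 0 \<longleftrightarrow> x = 0"
    by (simp add: inner_ell2_def cinner_self_ell2 norm_eq_zero_ell2)
  have "norm x \<ge> 0" by transfer (simp add: infsum_nonneg)
  then show "norm x = sqrt (inner x x)" by (simp add: inner_ell2_def cinner_self_ell2)
qed (simp_all add: uniformity_ell2_def open_ell2_def)

end

lemma norm_scaleC: "norm (scaleC c x) = cmod c * norm x"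
  by transfer (simp add: norm_mult power_mult_distrib infsum_cmult_right' real_sqrt_mult)

lemma Rep_ell2_summable: "(\<lambda>i. (cmod (Rep_ell2 x i))\<^sup>2) summable_on UNIV"
  using Rep_ell2[of x] by simp

lemma norm_ell2_sq: "(norm x)\<^sup>2 = infsum (\<lambda>i. (cmod (Rep_ell2 x i))\<^sup>2) UNIV"
  by transfer (simp add: infsum_nonneg)

lemma ell2_finite_sum_le:
  assumes "finite F"
  shows "(\<Sum>i\<in>F. (cmod (Rep_ell2 x i))\<^sup>2) \<le> (norm x)\<^sup>2"
  unfolding norm_ell2_sq using assms
  by (intro finite_sum_le_infsum Rep_ell2_summable) auto

lemma ell2_coeff_le: "cmod (Rep_ell2 x i) \<le> norm x"
  using ell2_finite_sum_le[of "{i}" x] by (auto intro: power2_le_imp_le)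

lemma ell2_boundedI:
  assumes "\<And>F. finite F \<Longrightarrow> (\<Sum>i\<in>F. (cmod (x i))\<^sup>2) \<le> B"
  shows "(\<lambda>i. (cmod (x i))\<^sup>2) summable_on UNIV"
    and "(norm (Abs_ell2 x))\<^sup>2 \<le> B"
proof -
  show *: "(\<lambda>i. (cmod (x i))\<^sup>2) summable_on UNIV"
    by (rule nonneg_bdd_above_summable_on) (auto intro!: bdd_aboveI[of _ B] assms)
  show "(norm (Abs_ell2 x))\<^sup>2 \<le> B"
    using * by (auto simp: norm_ell2_sq Abs_ell2_inverse intro!: infsum_le_finite_sums assms)
qed

lemma Rep_ell2_diff: "Rep_ell2 (x - y) i = Rep_ell2 x i - Rep_ell2 y i"
  by (simp only: minus_ell2_def plus_ell2.rep_eq uminus_ell2.rep_eq) simp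

instance ell2 :: (type) banach
proof
  fix X :: "nat \<Rightarrow> 'a ell2"
  assume X: "Cauchy X"
  have "Cauchy (\<lambda>n. Rep_ell2 (X n) i)" for i
  proof (rule metric_CauchyI)
    fix e :: real assume "e > 0"
    then obtain M where M: "\<And>m n. m \<ge> M \<Longrightarrow> n \<ge> M \<Longrightarrow> dist (X m) (X n) < e"
      using metric_CauchyD[OF X] by blast
    have "dist (Rep_ell2 (X m) i) (Rep_ell2 (X n) i) \<le> dist (X m) (X n)" for m n
      using ell2_coeff_le[of "X m - X n" i] by (simp add: dist_norm Rep_ell2_diff)
    then show "\<exists>M. \<forall>m\<ge>M. \<forall>n\<ge>M. dist (Rep_ell2 (X m) i) (Rep_ell2 (X n) i) < e"
      using M by (meson le_less_trans)
  qed
  then have "\<exists>l. (\<lambda>n. Rep_ell2 (X n) i) \<longlonglongrightarrow> l" for i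
    by (simp add: Cauchy_convergent_iff convergent_def)
  then obtain L where L: "\<And>i. (\<lambda>n. Rep_ell2 (X n) i) \<longlonglongrightarrow> L i" by metis
  have tail: "(\<Sum>i\<in>F. (cmod (Rep_ell2 (X m) i - L i))\<^sup>2) \<le> e\<^sup>2"
    if "finite F" "e > 0" "\<And>n. n \<ge> M \<Longrightarrow> dist (X m) (X n) < e" for F e m M
  proof (rule LIMSEQ_le_const2)
    show "(\<lambda>n. \<Sum>i\<in>F. (cmod (Rep_ell2 (X m) i - Rep_ell2 (X n) i))\<^sup>2)
        \<longlonglongrightarrow> (\<Sum>i\<in>F. (cmod (Rep_ell2 (X m) i - L i))\<^sup>2)"
      by (intro tendsto_intros L)
    have "(\<Sum>i\<in>F. (cmod (Rep_ell2 (X m) i - Rep_ell2 (X n) i))\<^sup>2) \<le> e\<^sup>2" if "n \<ge> M" for n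
    proof -
      have "(\<Sum>i\<in>F. (cmod (Rep_ell2 (X m) i - Rep_ell2 (X n) i))\<^sup>2) \<le> (norm (X m - X n))\<^sup>2"
        using ell2_finite_sum_le[OF \<open>finite F\<close>, of "X m - X n"] by (simp add: Rep_ell2_diff)
      also have "\<dots> \<le> e\<^sup>2"
        using \<open>\<And>n. n \<ge> M \<Longrightarrow> dist (X m) (X n) < e\<close>[OF that]
        by (intro power_mono) (auto simp: dist_norm)
      finally show ?thesis .
    qed
    then show "\<exists>N. \<forall>n\<ge>N. (\<Sum>i\<in>F. (cmod (Rep_ell2 (X m) i - Rep_ell2 (X n) i))\<^sup>2) \<le> e\<^sup>2"
      by blast
  qed
  obtain M1 where M1: "\<And>m n. m \<ge> M1 \<Longrightarrow> n \<ge> M1 \<Longrightarrow> dist (X m) (X n) < 1"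
    using metric_CauchyD[OF X, of 1] by auto
  have "(\<lambda>i. (cmod (Rep_ell2 (X M1) i - L i))\<^sup>2) summable_on UNIV"
    by (rule ell2_boundedI(1)[of _ "1\<^sup>2"]) (rule tail[of _ 1 M1], use M1 in auto)
  then have "(\<lambda>i. (cmod (Rep_ell2 (X M1) i + - (Rep_ell2 (X M1) i - L i)))\<^sup>2) summable_on UNIV"
    by (intro ell2_add Rep_ell2_summable) (simp add: norm_minus_commute)
  then have "(\<lambda>i. (cmod (L i))\<^sup>2) summable_on UNIV" by simp
  then have RL: "Rep_ell2 (Abs_ell2 L) = L" by (simp add: Abs_ell2_inverse)
  have "X \<longlonglongrightarrow> Abs_ell2 L"
  proof (rule metric_LIMSEQ_I)
    fix r :: real assume "r > 0"
    then obtain M where M: "\<And>m n. m \<ge> M \<Longrightarrow> n \<ge> M \<Longrightarrow> dist (X m) (X n) < r / 2"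
      using metric_CauchyD[OF X, of "r / 2"] by auto
    have "dist (X m) (Abs_ell2 L) < r" if "m \<ge> M" for m
    proof -
      have "(norm (Abs_ell2 (Rep_ell2 (X m - Abs_ell2 L))))\<^sup>2 \<le> (r / 2)\<^sup>2"
        by (rule ell2_boundedI(2), unfold Rep_ell2_diff RL, rule tail[of _ "r / 2" M])
          (use M that \<open>r > 0\<close> in auto)
      then have "norm (X m - Abs_ell2 L) \<le> r / 2"
        using \<open>r > 0\<close> by (auto simp: Rep_ell2_inverse intro: power2_le_imp_le)
      then show ?thesis using \<open>r > 0\<close> by (simp add: dist_norm)
    qed
    then show "\<exists>M. \<forall>m\<ge>M. dist (X m) (Abs_ell2 L) < r" by blast
  qed
  then show "convergent X" by (auto simp: convergent_def)
qed

global_interpretation cvec: vector_space "scaleC :: complex \<Rightarrow> 'a ell2 \<Rightarrow> 'a ell2"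
  by standard (transfer, simp add: algebra_simps)+

lemma cinner_ket: "cinner x (ket i) = Rep_ell2 x i"
proof transfer
  fix x :: "'a \<Rightarrow> complex" and i
  have "infsum (\<lambda>j. x j * cnj (if j = i then 1 else 0)) UNIV
      = infsum (\<lambda>j. x j * cnj (if j = i then 1 else 0)) {i}"
    by (rule infsum_cong_neutral) auto
  then show "infsum (\<lambda>j. x j * cnj (if j = i then 1 else 0)) UNIV = x i" by simp
qed

section \<open>Bounded operators, invariant subspaces and reflexivity\<close>

text \<open>The library's type of bounded linear maps consists of the real-linear ones; the complex-linear
  ones among them form \<open>B(H)\<close>.\<close>
definition bounded_ops :: "('a ell2 \<Rightarrow>\<^sub>L 'a ell2) set" where
  "bounded_ops = {A. Vector_Spaces.linear scaleC scaleC (blinfun_apply A)}"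

lemma bounded_linear_scaleC: "bounded_linear (scaleC c :: 'a ell2 \<Rightarrow> 'a ell2)"
  by (rule bounded_linear_intro[of _ "cmod c"])
    (auto simp: cvec.scale_right_distrib scaleR_ell2_def norm_scaleC mult.commute)

definition scaleC_op :: "complex \<Rightarrow> ('a ell2 \<Rightarrow>\<^sub>L 'a ell2) \<Rightarrow> ('a ell2 \<Rightarrow>\<^sub>L 'a ell2)" where
  "scaleC_op c A = Blinfun (\<lambda>x. scaleC c (blinfun_apply A x))"

lemma scaleC_op_apply: "blinfun_apply (scaleC_op c A) x = scaleC c (blinfun_apply A x)"
  unfolding scaleC_op_def
  by (subst bounded_linear_Blinfun_apply)
    (auto intro: bounded_linear_compose[OF bounded_linear_scaleC] blinfun.bounded_linear_right)

global_interpretation cop: vector_space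
  "scaleC_op :: complex \<Rightarrow> ('a ell2 \<Rightarrow>\<^sub>L 'a ell2) \<Rightarrow> ('a ell2 \<Rightarrow>\<^sub>L 'a ell2)"
  by standard (auto intro!: blinfun_eqI simp: scaleC_op_apply blinfun.add_left
      cvec.scale_right_distrib cvec.scale_left_distrib)

definition subalgebra :: "('a ell2 \<Rightarrow>\<^sub>L 'a ell2) set \<Rightarrow> bool" where
  "subalgebra U \<longleftrightarrow> U \<subseteq> bounded_ops \<and> cop.subspace U \<and> (\<forall>A\<in>U. \<forall>B\<in>U. A o\<^sub>L B \<in> U)"

definition sot_closed :: "('a ell2 \<Rightarrow>\<^sub>L 'a ell2) set \<Rightarrow> bool" where
  "sot_closed U \<longleftrightarrow> closedin (subtopology strong_operator_topology bounded_ops) U"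

definition Lat_op :: "('a ell2 \<Rightarrow>\<^sub>L 'a ell2) \<Rightarrow> 'a ell2 set set" where
  "Lat_op A = {M. cvec.subspace M \<and> closed M \<and> blinfun_apply A ` M \<subseteq> M}"

definition Lat :: "('a ell2 \<Rightarrow>\<^sub>L 'a ell2) set \<Rightarrow> 'a ell2 set set" where
  "Lat U = (\<Inter>A\<in>U. Lat_op A)"

definition Alg :: "'a ell2 set set \<Rightarrow> ('a ell2 \<Rightarrow>\<^sub>L 'a ell2) set" where
  "Alg S = {A \<in> bounded_ops. S \<subseteq> Lat_op A}"

definition reflexive :: "('a ell2 \<Rightarrow>\<^sub>L 'a ell2) set \<Rightarrow> bool" where
  "reflexive U \<longleftrightarrow> U = Alg (Lat U)"

section \<open>The full Fock space\<close>

text \<open>The alphabet \<open>\<Lambda>\<close> is the type \<open>'n\<close> (finite, with \<open>CARD('n) = n \<ge> 1\<close>, in the theorem), words are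
  lists, and \<open>ket f\<close> is \<open>e\<^sub>f\<close>.\<close>
type_synonym 'n fock = "'n list ell2"

definition fock_coeff :: "'n fock \<Rightarrow> 'n fock \<Rightarrow> 'n list \<Rightarrow> complex" where
  "fock_coeff \<phi> \<psi> h = (\<Sum>(f, g)\<in>{(f, g). f @ g = h}. cinner \<phi> (ket f) * cinner \<psi> (ket g))"

text \<open>The product is meaningful only if these coefficients are square-summable, which they
  are when \<open>\<psi>\<close> is a polynomial or \<open>\<phi>\<close> lies in \<open>F_inf\<close> (see below).\<close>
definition ftimes :: "'n fock \<Rightarrow> 'n fock \<Rightarrow> 'n fock"  (infixl "\<otimes>" 70) where
  "\<phi> \<otimes> \<psi> = Abs_ell2 (fock_coeff \<phi> \<psi>)"

definition polys :: "'n fock set" where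
  "polys = cvec.span (range ket)"

definition norm_inf :: "'n fock \<Rightarrow> ereal" where
  "norm_inf g = (SUP p\<in>{p \<in> polys. norm p \<le> 1}. ereal (norm (g \<otimes> p)))"

definition F_inf :: "'n fock set" where
  "F_inf = {g. norm_inf g < \<infinity>}"

definition fock_op :: "'n fock \<Rightarrow> ('n fock \<Rightarrow>\<^sub>L 'n fock)" where
  "fock_op \<phi> = Blinfun (\<lambda>\<psi>. \<phi> \<otimes> \<psi>)"

subsection \<open>Well-definedness\<close>

lemma finite_splits: "finite {(f, g). f @ g = (h :: 'n list)}"
proof (rule finite_subset)
  show "{(f, g). f @ g = h} \<subseteq> (\<lambda>k. (take k h, drop k h)) ` {..length h}"
  proof (clarify)
    fix f g assume "h = f @ g"
    then show "(f, g) \<in> (\<lambda>k. (take k (f @ g), drop k (f @ g))) ` {..length (f @ g)}"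
      by (intro image_eqI[of _ _ "length f"]) auto
  qed
qed simp

lemma fock_coeff_Rep:
  "fock_coeff \<phi> \<psi> h = (\<Sum>(f, g)\<in>{(f, g). f @ g = h}. Rep_ell2 \<phi> f * Rep_ell2 \<psi> g)"
  by (simp add: fock_coeff_def cinner_ket)

lemma fock_coeff_add: "fock_coeff \<phi> (x + y) h = fock_coeff \<phi> x h + fock_coeff \<phi> y h"
  by (simp add: fock_coeff_Rep plus_ell2.rep_eq distrib_left sum.distrib case_prod_unfold)

lemma fock_coeff_scaleC: "fock_coeff \<phi> (scaleC c x) h = c * fock_coeff \<phi> x h"
  by (simp add: fock_coeff_Rep scaleC.rep_eq sum_distrib_left case_prod_unfold mult.left_commute)

lemma fock_coeff_ket:
  "fock_coeff \<phi> (ket g) h = (if \<exists>f. f @ g = h then Rep_ell2 \<phi> (THE f. f @ g = h) else 0)"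
proof (cases "\<exists>f. f @ g = h")
  case True
  then obtain f where f: "f @ g = h" by blast
  then have "(THE f. f @ g = h) = f" by auto
  moreover have "fock_coeff \<phi> (ket g) h
      = (\<Sum>(f', g')\<in>{(f, g)}. Rep_ell2 \<phi> f' * Rep_ell2 (ket g) g')"
    unfolding fock_coeff_Rep
    by (rule sum.mono_neutral_right[OF finite_splits]) (use f in \<open>auto simp: ket.rep_eq split: if_splits\<close>)
  ultimately show ?thesis using f by (auto simp: ket.rep_eq)
next
  case False
  then show ?thesis
    unfolding fock_coeff_Rep by (auto simp: ket.rep_eq intro!: sum.neutral)
qed

lemma fock_coeff_ket_summable: "(\<lambda>h. (cmod (fock_coeff \<phi> (ket g) h))\<^sup>2) summable_on UNIV"
proof -
  have "(\<lambda>h. (cmod (fock_coeff \<phi> (ket g) h))\<^sup>2) summable_on range (\<lambda>f. f @ g)"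
    by (subst summable_on_reindex)
      (auto simp: inj_def o_def fock_coeff_ket intro: Rep_ell2_summable)
  then show ?thesis
    by (rule summable_on_cong_neutral[THEN iffD1, rotated -1]) (auto simp: fock_coeff_ket)
qed

lemma fock_coeff_poly_summable:
  assumes "p \<in> polys"
  shows "(\<lambda>h. (cmod (fock_coeff \<phi> p h))\<^sup>2) summable_on UNIV"
  using assms unfolding polys_def
proof (induction rule: cvec.span_induct_alt)
  case base
  have "fock_coeff \<phi> 0 h = 0" for h
    using fock_coeff_scaleC[of \<phi> 0 0] by simp
  then show ?case by simp
next
  case (step c x y)
  then show ?case
    using ell2_add[OF ell2_scale[of "fock_coeff \<phi> x" c], of "fock_coeff \<phi> y"]
    by (auto simp: fock_coeff_add fock_coeff_scaleC fock_coeff_ket_summable)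
qed

definition trunc :: "'a set \<Rightarrow> 'a ell2 \<Rightarrow> 'a ell2" where
  "trunc F x = (\<Sum>i\<in>F. scaleC (Rep_ell2 x i) (ket i))"

lemma Rep_trunc:
  assumes "finite F"
  shows "Rep_ell2 (trunc F x) j = (if j \<in> F then Rep_ell2 x j else 0)"
proof -
  have "Rep_ell2 (\<Sum>i\<in>F. y i) j = (\<Sum>i\<in>F. Rep_ell2 (y i) j)" for y :: "_ \<Rightarrow> 'a ell2"
    using assms by (induction F) (auto simp: zero_ell2.rep_eq plus_ell2.rep_eq)
  then show ?thesis
    using assms by (simp add: trunc_def scaleC.rep_eq ket.rep_eq if_distrib cong: if_cong)
qed

lemma norm_trunc_le:
  assumes "finite F"
  shows "norm (trunc F x) \<le> norm x"
proof (rule power2_le_imp_le)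
  have "(norm (trunc F x))\<^sup>2 = infsum (\<lambda>i. (cmod (Rep_ell2 (trunc F x) i))\<^sup>2) UNIV"
    by (rule norm_ell2_sq)
  also have "\<dots> \<le> infsum (\<lambda>i. (cmod (Rep_ell2 x i))\<^sup>2) UNIV"
    by (intro infsum_mono Rep_ell2_summable) (auto simp: Rep_trunc[OF assms])
  finally show "(norm (trunc F x))\<^sup>2 \<le> (norm x)\<^sup>2" by (simp add: norm_ell2_sq)
qed simp

lemma F_inf_poly_bound:
  assumes "\<phi> \<in> F_inf"
  obtains C where "C \<ge> 0" "\<And>p. p \<in> polys \<Longrightarrow> norm (\<phi> \<otimes> p) \<le> C * norm p"
proof -
  have z: "0 \<in> {p \<in> polys. norm p \<le> 1}" by (simp add: polys_def cvec.span_zero)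
  have "0 \<le> norm_inf \<phi>"
    unfolding norm_inf_def by (rule SUP_upper2[OF z]) simp
  moreover have "norm_inf \<phi> < \<infinity>" using assms by (simp add: F_inf_def)
  ultimately obtain C where C: "norm_inf \<phi> = ereal C" "C \<ge> 0"
    by (cases "norm_inf \<phi>") auto
  have le: "norm (\<phi> \<otimes> p) \<le> C" if "p \<in> polys" "norm p \<le> 1" for p
  proof -
    have "ereal (norm (\<phi> \<otimes> p)) \<le> norm_inf \<phi>"
      unfolding norm_inf_def by (rule SUP_upper) (use that in auto)
    then show ?thesis using C by simp
  qed
  have "norm (\<phi> \<otimes> p) \<le> C * norm p" if p: "p \<in> polys" for p
  proof (cases "p = 0")
    case True
    have "fock_coeff \<phi> 0 = (\<lambda>_. 0)"
      using fock_coeff_scaleC[of \<phi> 0 0] by auto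
    then show ?thesis using True by (simp add: ftimes_def zero_ell2_def[symmetric])
  next
    case False
    define c where "c = complex_of_real (1 / norm p)"
    have cp: "scaleC c p \<in> polys" "norm (scaleC c p) \<le> 1"
      using p False by (auto simp: polys_def c_def norm_scaleC norm_divide intro: cvec.span_scale)
    have "\<phi> \<otimes> scaleC c p = scaleC c (\<phi> \<otimes> p)"
      using fock_coeff_poly_summable[OF p, of \<phi>] fock_coeff_poly_summable[OF cp(1), of \<phi>]
      by (intro Rep_ell2_inject[THEN iffD1] ext)
        (simp add: ftimes_def scaleC.rep_eq Abs_ell2_inverse fock_coeff_scaleC)
    then have "cmod c * norm (\<phi> \<otimes> p) \<le> C"
      using le[OF cp] by (simp add: norm_scaleC)
    then show ?thesis using False by (simp add: c_def norm_divide field_simps)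
  qed
  with C(2) show thesis by (rule that)
qed

lemma fock_coeff_partial_sums:
  assumes "\<phi> \<in> F_inf"
  obtains C where "C \<ge> 0"
    "\<And>\<psi> W. finite W \<Longrightarrow> (\<Sum>h\<in>W. (cmod (fock_coeff \<phi> \<psi> h))\<^sup>2) \<le> (C * norm \<psi>)\<^sup>2"
proof -
  obtain C where C: "C \<ge> 0" "\<And>p. p \<in> polys \<Longrightarrow> norm (\<phi> \<otimes> p) \<le> C * norm p"
    using F_inf_poly_bound[OF assms] by blast
  have "(\<Sum>h\<in>W. (cmod (fock_coeff \<phi> \<psi> h))\<^sup>2) \<le> (C * norm \<psi>)\<^sup>2" if W: "finite W" for \<psi> W
  proof -
    define G where "G = (\<Union>h\<in>W. snd ` {(f, g). f @ g = h})"
    define p where "p = trunc G \<psi>"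
    have G: "finite G" unfolding G_def using W finite_splits by blast
    have p: "p \<in> polys"
      unfolding p_def trunc_def polys_def
      by (intro cvec.span_sum cvec.span_scale cvec.span_base) auto
    have eq: "fock_coeff \<phi> \<psi> h = fock_coeff \<phi> p h" if "h \<in> W" for h
      unfolding fock_coeff_Rep p_def
    proof (rule sum.cong[OF refl], clarify)
      fix f g assume "h = f @ g"
      then have "g \<in> G" unfolding G_def using \<open>h \<in> W\<close> by force
      then show "Rep_ell2 \<phi> f * Rep_ell2 \<psi> g = Rep_ell2 \<phi> f * Rep_ell2 (trunc G \<psi>) g"
        by (simp add: Rep_trunc[OF G])
    qed
    have "(\<Sum>h\<in>W. (cmod (fock_coeff \<phi> \<psi> h))\<^sup>2) = (\<Sum>h\<in>W. (cmod (Rep_ell2 (\<phi> \<otimes> p) h))\<^sup>2)"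
      by (rule sum.cong)
        (auto simp: eq ftimes_def Abs_ell2_inverse fock_coeff_poly_summable[OF p])
    also have "\<dots> \<le> (norm (\<phi> \<otimes> p))\<^sup>2" by (rule ell2_finite_sum_le[OF W])
    also have "\<dots> \<le> (C * norm \<psi>)\<^sup>2"
      using C(2)[OF p] norm_trunc_le[OF G, of \<psi>] C(1)
      by (intro power_mono order_trans[OF C(2)[OF p]] mult_left_mono) (auto simp: p_def)
    finally show ?thesis .
  qed
  with C(1) show thesis by (rule that)
qed

lemma cinner_ftimes:
  assumes "\<phi> \<in> F_inf \<or> \<psi> \<in> polys"
  shows "cinner (\<phi> \<otimes> \<psi>) (ket h)
    = (\<Sum>(f, g)\<in>{(f, g). f @ g = h}. cinner \<phi> (ket f) * cinner \<psi> (ket g))"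
proof -
  have "(\<lambda>h. (cmod (fock_coeff \<phi> \<psi> h))\<^sup>2) summable_on UNIV"
    using assms
  proof
    assume "\<phi> \<in> F_inf"
    then obtain C where C: "C \<ge> 0"
      "\<And>\<psi> W. finite W \<Longrightarrow> (\<Sum>h\<in>W. (cmod (fock_coeff \<phi> \<psi> h))\<^sup>2) \<le> (C * norm \<psi>)\<^sup>2"
      using fock_coeff_partial_sums by blast
    show ?thesis by (rule ell2_boundedI(1)) (rule C(2))
  qed (rule fock_coeff_poly_summable)
  then show ?thesis
    by (simp add: cinner_ket ftimes_def Abs_ell2_inverse fock_coeff_Rep)
qed

lemma bounded_linear_ftimes:
  assumes "\<phi> \<in> F_inf"
  shows "bounded_linear (\<lambda>\<psi>. \<phi> \<otimes> \<psi>)"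
    and "\<phi> \<otimes> scaleC c \<psi> = scaleC c (\<phi> \<otimes> \<psi>)"
proof -
  obtain C where C: "C \<ge> 0"
    "\<And>\<psi> W. finite W \<Longrightarrow> (\<Sum>h\<in>W. (cmod (fock_coeff \<phi> \<psi> h))\<^sup>2) \<le> (C * norm \<psi>)\<^sup>2"
    using fock_coeff_partial_sums[OF assms] by blast
  have R: "Rep_ell2 (\<phi> \<otimes> \<psi>) h = fock_coeff \<phi> \<psi> h" for \<psi> h
    using cinner_ftimes[of \<phi> \<psi> h] assms by (simp add: cinner_ket fock_coeff_Rep)
  have sc: "\<phi> \<otimes> scaleC c \<psi> = scaleC c (\<phi> \<otimes> \<psi>)" for c \<psi>
    by (rule Rep_ell2_inject[THEN iffD1]) (auto simp: R scaleC.rep_eq fock_coeff_scaleC)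
  show "bounded_linear (\<lambda>\<psi>. \<phi> \<otimes> \<psi>)"
  proof (rule bounded_linear_intro)
    fix x y :: "'a fock" and r :: real
    show "\<phi> \<otimes> (x + y) = \<phi> \<otimes> x + \<phi> \<otimes> y"
      by (rule Rep_ell2_inject[THEN iffD1]) (auto simp: R plus_ell2.rep_eq fock_coeff_add)
    show "\<phi> \<otimes> (r *\<^sub>R x) = r *\<^sub>R (\<phi> \<otimes> x)" by (simp add: scaleR_ell2_def sc)
    have "(norm (\<phi> \<otimes> x))\<^sup>2 \<le> (C * norm x)\<^sup>2"
      unfolding ftimes_def by (rule ell2_boundedI(2)) (rule C(2))
    then show "norm (\<phi> \<otimes> x) \<le> norm x * C"
      using C(1) by (auto simp: mult.commute intro: power2_le_imp_le)
  qed
  show "\<phi> \<otimes> scaleC c \<psi> = scaleC c (\<phi> \<otimes> \<psi>)" by (rule sc)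
qed

lemma fock_op_apply:
  assumes "\<phi> \<in> F_inf"
  shows "blinfun_apply (fock_op \<phi>) \<psi> = \<phi> \<otimes> \<psi>"
  by (simp add: fock_op_def bounded_linear_Blinfun_apply bounded_linear_ftimes(1)[OF assms])

lemma fock_op_in_bounded_ops:
  assumes "\<phi> \<in> F_inf"
  shows "fock_op \<phi> \<in> bounded_ops"
  unfolding bounded_ops_def mem_Collect_eq Vector_Spaces.linear_def
    module_hom_def module_hom_axioms_def
  using bounded_linear_ftimes[OF assms]
  by (auto simp: fock_op_apply[OF assms] cvec.vector_space_axioms cvec.module_axioms
      linear_add[OF bounded_linear.linear])

end

theory Submission
  imports Defs
begin

text \<open>Let \<open>A \<in> Alg (Lat U)\<close>. For every single vector \<open>u\<close>, the closure of \<open>{B u | B \<in> U}\<close> is invariant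
  under \<open>U\<close> and contains \<open>u\<close>, so it contains \<open>A u\<close>: pointwise, \<open>A\<close> is approximated by elements of
  \<open>U\<close>. Membership in the strong operator closure asks for more, namely one \<open>B \<in> U\<close> that is close
  to \<open>A\<close> on finitely many vectors \<open>x\<^sub>1, \<dots>, x\<^sub>k\<close> at once. Two facts about the Fock space reduce this to
  a single vector.

  First, a finite family of vectors has a common left factor (\<open>common_left_factor\<close>): there are \<open>u\<close>
  and \<open>w\<^sub>1, \<dots>, w\<^sub>k\<close> with \<open>x\<^sub>j = u \<otimes> w\<^sub>j\<close> such that right multiplication by each \<open>w\<^sub>j\<close> is a
  contraction. This is a Wold decomposition: in the closed invariant subspace generated by the column
  \<open>(x\<^sub>1, \<dots>, x\<^sub>k)\<close>, the part of the column orthogonal to its proper translates is a wandering vector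
  whose translates form an orthogonal family spanning the subspace, and \<open>u\<close> collects the Fourier
  coefficients of the column.

  Second, \<open>A\<close> is left multiplication by some \<open>\<phi> \<in> F_inf\<close> (\<open>Alg_Lat_F_inf\<close>). For the right creation
  operators \<open>R\<close> and small \<open>s \<ge> 0\<close>, the ranges of \<open>s - R\<close> are closed and invariant under all left
  multiplications, hence under \<open>A\<close>; comparing them as \<open>s \<rightarrow> 0\<close> forces \<open>A R = R A\<close>, and an operator
  commuting with every \<open>R\<close> is determined by its value \<open>\<phi>\<close> at the empty word.

  If now \<open>B \<in> U\<close> has \<open>B u\<close> close to \<open>A u\<close>, then by associativity
  \<open>B x\<^sub>j - A x\<^sub>j = (B u - A u) \<otimes> w\<^sub>j\<close> is small for all \<open>j\<close> at once. As \<open>U\<close> is strongly closed,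
  \<open>A \<in> U\<close>.\<close>

section \<open>Orthogonality in a complex Hilbert space\<close>

text \<open>By the parallelogram law, a sequence in the subspace whose distances to \<open>x\<close> tend to the infimum
  is Cauchy.\<close>
lemma closest_point_of_closed_subspace_exists:
  fixes N :: "'a::{real_inner, banach} set"
  assumes N: "subspace N" "closed N"
  obtains n where "n \<in> N" "\<And>m. m \<in> N \<Longrightarrow> norm (x - n) \<le> norm (x - m)"
proof -
  define D where "D = (INF m\<in>N. (norm (x - m))\<^sup>2)"
  have bdd: "bdd_below ((\<lambda>m. (norm (x - m))\<^sup>2) ` N)"
    by (auto intro: bdd_belowI[of _ 0])
  have ne: "N \<noteq> {}" using N(1) subspace_0 by blast
  have low: "D \<le> (norm (x - m))\<^sup>2" if "m \<in> N" for m
    unfolding D_def by (rule cINF_lower[OF bdd that])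
  have "\<exists>m\<in>N. (norm (x - m))\<^sup>2 < D + 1 / real (Suc k)" for k
    using cINF_less_iff[OF ne bdd, of "D + 1 / real (Suc k)"] by (auto simp: D_def[symmetric])
  then obtain y where yN: "\<And>k. y k \<in> N"
    and y: "\<And>k. (norm (x - y k))\<^sup>2 < D + 1 / real (Suc k)" by metis
  have close: "(norm (y k - y l))\<^sup>2 \<le> 2 / real (Suc k) + 2 / real (Suc l)" for k l
  proof -
    have "(1/2) *\<^sub>R (y k + y l) \<in> N"
      using N(1) yN by (intro subspace_scale subspace_add)
    then have "4 * D \<le> 4 * (norm (x - (1/2) *\<^sub>R (y k + y l)))\<^sup>2" using low by simp
    also have "\<dots> = 2 * (norm (x - y k))\<^sup>2 + 2 * (norm (x - y l))\<^sup>2 - (norm (y k - y l))\<^sup>2"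
      by (simp add: power2_norm_eq_inner inner_simps inner_commute algebra_simps)
    finally show ?thesis using y[of k] y[of l] by simp
  qed
  have "Cauchy y"
  proof (rule metric_CauchyI)
    fix e :: real assume e: "e > 0"
    then obtain M where M: "4 / e\<^sup>2 < real M" using reals_Archimedean2 by blast
    have "dist (y k) (y l) < e" if "k \<ge> M" "l \<ge> M" for k l
    proof -
      have "0 < real M" using M e by (smt (verit) divide_pos_pos zero_less_power)
      have "2 / real (Suc k) \<le> 2 / real (Suc M)" "2 / real (Suc l) \<le> 2 / real (Suc M)"
        using that by (auto intro!: divide_left_mono)
      then have "(norm (y k - y l))\<^sup>2 \<le> 4 / real (Suc M)" using close[of k l] by simp
      also have "\<dots> < 4 / real M"
        using \<open>0 < real M\<close> by (intro divide_strict_left_mono) auto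
      also have "\<dots> < e\<^sup>2" using M e \<open>0 < real M\<close> by (simp add: field_simps)
      finally show ?thesis using e by (auto simp: dist_norm intro: power2_less_imp_less)
    qed
    then show "\<exists>M. \<forall>k\<ge>M. \<forall>l\<ge>M. dist (y k) (y l) < e" by blast
  qed
  then obtain n where n: "y \<longlonglongrightarrow> n" by (auto simp: Cauchy_convergent_iff convergent_def)
  have "n \<in> N" using closed_sequentially[OF N(2)] yN n by blast
  moreover have "norm (x - n) \<le> norm (x - m)" if "m \<in> N" for m
  proof -
    have "(\<lambda>k. (norm (x - y k))\<^sup>2) \<longlonglongrightarrow> (norm (x - n))\<^sup>2" by (intro tendsto_intros n)
    moreover have "(\<lambda>k. D + 1 / real (Suc k)) \<longlonglongrightarrow> D + 0"
      by (intro tendsto_add tendsto_const LIMSEQ_Suc[OF lim_1_over_n])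
    ultimately have "(norm (x - n))\<^sup>2 \<le> D + 0"
      by (rule LIMSEQ_le) (use y less_imp_le in blast)
    then have "(norm (x - n))\<^sup>2 \<le> (norm (x - m))\<^sup>2" using low[OF that] by linarith
    then show ?thesis by (rule power2_le_imp_le) simp
  qed
  ultimately show thesis by (rule that)
qed

lemma inner_zero_if_norm_minimal:
  fixes z m :: "'a::real_inner"
  assumes "\<And>t. norm z \<le> norm (z - t *\<^sub>R m)"
  shows "inner z m = 0"
proof (cases "m = 0")
  case False
  define t where "t = inner z m / inner m m"
  have mm: "inner m m > 0" using False by simp
  have "(norm z)\<^sup>2 \<le> (norm (z - t *\<^sub>R m))\<^sup>2" using assms by (intro power_mono) auto
  also have "\<dots> = (norm z)\<^sup>2 - 2 * t * inner z m + t * (t * inner m m)"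
    by (simp add: power2_norm_eq_inner inner_simps inner_commute algebra_simps)
  also have "\<dots> = (norm z)\<^sup>2 - (inner z m)\<^sup>2 / inner m m"
    using mm by (simp add: t_def field_simps power2_eq_square)
  finally have "(inner z m)\<^sup>2 / inner m m \<le> 0" by simp
  then show ?thesis using mm by (simp add: divide_le_0_iff)
qed simp

lemma cinner_scaleC_right: "cinner x (scaleC c y) = cnj c * cinner x y"
  by (metis cinner_commute_ell2 cinner_scaleC_left_ell2 complex_cnj_mult)

lemma cinner_add_right: "cinner x (y + z) = cinner x y + cinner x z"
  by (metis cinner_commute_ell2 cinner_add_left_ell2 complex_cnj_add)

lemma cinner_zero_left [simp]: "cinner 0 x = 0"
  using cinner_scaleC_left_ell2[of 0 0 x] by simp

lemma cinner_zero_right [simp]: "cinner x 0 = 0"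
  using cinner_scaleC_right[of x 0 0] by simp

lemma cinner_minus_left [simp]: "cinner (- x) y = - cinner x y"
  using cinner_add_left_ell2[of x "- x" y] by (simp add: add_eq_0_iff)

lemma cinner_diff_left: "cinner (x - y) z = cinner x z - cinner y z"
  using cinner_add_left_ell2[of x "- y" z] by simp

lemma cinner_sum_left: "cinner (\<Sum>i\<in>I. x i) y = (\<Sum>i\<in>I. cinner (x i) y)"
  by (induction I rule: infinite_finite_induct) (auto simp: cinner_add_left_ell2)

lemma cinner_sum_right: "cinner y (\<Sum>i\<in>I. x i) = (\<Sum>i\<in>I. cinner y (x i))"
  by (induction I rule: infinite_finite_induct) (auto simp: cinner_add_right)

lemma cinner_eq_inner:
  "cinner x y = complex_of_real (inner x y) + \<i> * complex_of_real (inner x (scaleC \<i> y))"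
  by (simp add: inner_ell2_def cinner_scaleC_right complex_eq_iff)

lemma continuous_on_cinner_left [continuous_intros]:
  "continuous_on S f \<Longrightarrow> continuous_on S (\<lambda>x. cinner (f x) y)"
  unfolding cinner_eq_inner by (intro continuous_intros)

lemma continuous_on_Rep_ell2 [continuous_intros]:
  "continuous_on S f \<Longrightarrow> continuous_on S (\<lambda>x. Rep_ell2 (f x) i)"
  unfolding cinner_ket[symmetric] by (intro continuous_intros)

lemma ell2_eqI: "(\<And>i. Rep_ell2 x i = Rep_ell2 y i) \<Longrightarrow> x = y"
  by (metis Rep_ell2_inject ext)

lemma Rep_ell2_sum: "Rep_ell2 (\<Sum>j\<in>I. z j) i = (\<Sum>j\<in>I. Rep_ell2 (z j) i)"
  by (induction I rule: infinite_finite_induct) (auto simp: plus_ell2.rep_eq zero_ell2.rep_eq)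

lemma cvec_subspace_imp_subspace: "cvec.subspace N \<Longrightarrow> subspace N"
  unfolding subspace_def cvec.subspace_def scaleR_ell2_def by blast

lemma orthogonal_projection_exists:
  fixes N :: "'a ell2 set"
  assumes N: "cvec.subspace N" "closed N"
  obtains n where "n \<in> N" "\<And>m. m \<in> N \<Longrightarrow> cinner (x - n) m = 0"
proof -
  obtain n where n: "n \<in> N" "\<And>m. m \<in> N \<Longrightarrow> norm (x - n) \<le> norm (x - m)"
    using closest_point_of_closed_subspace_exists[OF cvec_subspace_imp_subspace[OF N(1)] N(2)] by blast
  have "inner (x - n) m = 0" if "m \<in> N" for m
  proof (rule inner_zero_if_norm_minimal)
    fix t
    have "n + t *\<^sub>R m \<in> N"
      using n(1) that N(1) by (simp add: scaleR_ell2_def cvec.subspace_add cvec.subspace_scale)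
    from n(2)[OF this] show "norm (x - n) \<le> norm (x - n - t *\<^sub>R m)" by (simp add: diff_diff_eq)
  qed
  then have "cinner (x - n) m = 0" if "m \<in> N" for m
    unfolding cinner_eq_inner using that N(1) by (simp add: cvec.subspace_scale)
  with n(1) show thesis by (rule that)
qed

text \<open>The vector left over by the projection onto the subspace is orthogonal to every basis
  vector, so it has no nonzero coordinate.\<close>
lemma closed_subspace_containing_kets:
  assumes "cvec.subspace S" "closed S" "\<And>i. ket i \<in> S"
  shows "x \<in> S"
proof -
  obtain n where n: "n \<in> S" "\<And>m. m \<in> S \<Longrightarrow> cinner (x - n) m = 0"
    using orthogonal_projection_exists[OF assms(1,2)] by blast
  have "Rep_ell2 (x - n) i = 0" for i using n(2)[OF assms(3)] by (simp add: cinner_ket)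
  then have "x - n = 0" by (intro ell2_eqI) (simp add: zero_ell2.rep_eq)
  then show ?thesis using n(1) by simp
qed

lemma subspace_closure:
  fixes S :: "'a ell2 set"
  assumes "cvec.subspace S"
  shows "cvec.subspace (closure S)"
proof (rule cvec.subspaceI)
  show "0 \<in> closure S" using cvec.subspace_0[OF assms] closure_subset by blast
next
  fix x y assume "x \<in> closure S" "y \<in> closure S"
  then obtain f g where fg: "\<And>n. f n \<in> S" "f \<longlonglongrightarrow> x" "\<And>n. g n \<in> S" "g \<longlonglongrightarrow> y"
    unfolding closure_sequential by metis
  then have "\<And>n. f n + g n \<in> S" "(\<lambda>n. f n + g n) \<longlonglongrightarrow> x + y"
    using assms by (auto intro: cvec.subspace_add tendsto_add)
  then show "x + y \<in> closure S" unfolding closure_sequential by (intro exI[of _ "\<lambda>n. f n + g n"]) auto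
next
  fix c x assume "x \<in> closure S"
  then have "scaleC c x \<in> scaleC c ` closure S" by blast
  also have "\<dots> \<subseteq> closure (scaleC c ` S)"
    by (rule closure_bounded_linear_image_subset[OF bounded_linear_scaleC])
  also have "\<dots> \<subseteq> closure S"
    by (rule closure_mono) (use assms in \<open>auto intro: cvec.subspace_scale\<close>)
  finally show "scaleC c x \<in> closure S" .
qed

definition closed_span :: "'a ell2 set \<Rightarrow> 'a ell2 set" where
  "closed_span S = closure (cvec.span S)"

lemma closed_closed_span [simp]: "closed (closed_span S)" by (simp add: closed_span_def)

lemma subspace_closed_span [simp]: "cvec.subspace (closed_span S)"
  by (simp add: closed_span_def subspace_closure)

lemma closed_span_base: "x \<in> S \<Longrightarrow> x \<in> closed_span S"
  unfolding closed_span_def using closure_subset cvec.span_base by blast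

lemma closed_span_minimal:
  "S \<subseteq> T \<Longrightarrow> cvec.subspace T \<Longrightarrow> closed T \<Longrightarrow> closed_span S \<subseteq> T"
  unfolding closed_span_def by (intro closure_minimal cvec.span_minimal)

section \<open>Isometries induced by injections of the index set\<close>

text \<open>The zero default for non-injective \<open>\<sigma>\<close> keeps \<open>push\<close> and \<open>pull\<close> total, since in general only
  an injection preserves square-summability. For injective \<open>\<sigma>\<close> they are an isometry and its
  adjoint; left and right creation and the inclusion of a single component of a column are all of
  this form.\<close>
lift_definition push :: "('a \<Rightarrow> 'b) \<Rightarrow> 'a ell2 \<Rightarrow> 'b ell2"
  is "\<lambda>\<sigma> x b. if inj \<sigma> \<and> b \<in> range \<sigma> then x (inv \<sigma> b) else 0"
proof -
  fix \<sigma> :: "'a \<Rightarrow> 'b" and x :: "'a \<Rightarrow> complex"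
  assume x: "(\<lambda>i. (cmod (x i))\<^sup>2) summable_on UNIV"
  show "(\<lambda>b. (cmod (if inj \<sigma> \<and> b \<in> range \<sigma> then x (inv \<sigma> b) else 0))\<^sup>2) summable_on UNIV"
  proof (cases "inj \<sigma>")
    case True
    then have "(\<lambda>b. (cmod (x (inv \<sigma> b)))\<^sup>2) summable_on range \<sigma>"
      using x by (simp add: summable_on_reindex o_def)
    then show ?thesis
      by (rule summable_on_cong_neutral[THEN iffD1, rotated -1]) (auto simp: True)
  qed simp
qed

lift_definition pull :: "('a \<Rightarrow> 'b) \<Rightarrow> 'b ell2 \<Rightarrow> 'a ell2"
  is "\<lambda>\<sigma> x a. if inj \<sigma> then x (\<sigma> a) else 0"
proof -
  fix \<sigma> :: "'a \<Rightarrow> 'b" and x :: "'b \<Rightarrow> complex"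
  assume x: "(\<lambda>i. (cmod (x i))\<^sup>2) summable_on UNIV"
  show "(\<lambda>a. (cmod (if inj \<sigma> then x (\<sigma> a) else 0))\<^sup>2) summable_on UNIV"
  proof (cases "inj \<sigma>")
    case True
    have "(\<lambda>i. (cmod (x i))\<^sup>2) summable_on range \<sigma>"
      using x by (rule summable_on_subset_banach) simp
    then show ?thesis using True by (simp add: summable_on_reindex o_def)
  qed simp
qed

lemma Rep_push_outside: "b \<notin> range \<sigma> \<Longrightarrow> Rep_ell2 (push \<sigma> x) b = 0"
  by (simp add: push.rep_eq)

context
  fixes \<sigma> :: "'a \<Rightarrow> 'b"
  assumes inj: "inj \<sigma>"
begin

lemma Rep_push [simp]: "Rep_ell2 (push \<sigma> x) (\<sigma> a) = Rep_ell2 x a"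
  by (simp add: push.rep_eq inj)

lemma Rep_pull [simp]: "Rep_ell2 (pull \<sigma> x) a = Rep_ell2 x (\<sigma> a)"
  by (simp add: pull.rep_eq inj)

lemma pull_push: "pull \<sigma> (push \<sigma> x) = x"
  by (rule ell2_eqI) simp

lemma push_ket: "push \<sigma> (ket a) = ket (\<sigma> a)"
proof (rule ell2_eqI)
  fix b
  show "Rep_ell2 (push \<sigma> (ket a)) b = Rep_ell2 (ket (\<sigma> a)) b"
  proof (cases "b \<in> range \<sigma>")
    case True
    then show ?thesis by (auto simp: ket.rep_eq inj_eq[OF inj])
  next
    case False
    then show ?thesis by (auto simp: Rep_push_outside ket.rep_eq)
  qed
qed

lemma cinner_push: "cinner (push \<sigma> x) y = cinner x (pull \<sigma> y)"
proof -
  have "cinner (push \<sigma> x) y = infsum (\<lambda>b. Rep_ell2 (push \<sigma> x) b * cnj (Rep_ell2 y b)) (range \<sigma>)"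
    unfolding cinner.rep_eq by (rule infsum_cong_neutral) (auto simp: Rep_push_outside)
  also have "\<dots> = cinner x (pull \<sigma> y)"
    unfolding cinner.rep_eq by (simp add: infsum_reindex[OF inj] o_def)
  finally show ?thesis .
qed

lemma norm_push: "norm (push \<sigma> x) = norm x"
proof -
  have "cinner (push \<sigma> x) (push \<sigma> x) = cinner x x" by (simp add: cinner_push pull_push)
  then have "(norm (push \<sigma> x))\<^sup>2 = (norm x)\<^sup>2"
    unfolding cinner_self_ell2 of_real_eq_iff .
  then show ?thesis by simp
qed

lemma norm_pull_le: "norm (pull \<sigma> y) \<le> norm y"
proof -
  have "(norm (pull \<sigma> y))\<^sup>2 = inner (push \<sigma> (pull \<sigma> y)) y"
    by (simp add: inner_ell2_def cinner_push cinner_self_ell2)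
  also have "\<dots> \<le> norm (pull \<sigma> y) * norm y"
    using norm_cauchy_schwarz[of "push \<sigma> (pull \<sigma> y)" y] by (simp add: norm_push)
  finally show ?thesis by (cases "pull \<sigma> y = 0") (simp_all add: power2_eq_square)
qed

end

lemma push_add: "push \<sigma> (x + y) = push \<sigma> x + push \<sigma> y"
  by (rule ell2_eqI) (simp add: push.rep_eq plus_ell2.rep_eq)

lemma push_scaleC: "push \<sigma> (scaleC c x) = scaleC c (push \<sigma> x)"
  by (rule ell2_eqI) (simp add: push.rep_eq scaleC.rep_eq)

lemma pull_add: "pull \<sigma> (x + y) = pull \<sigma> x + pull \<sigma> y"
  by (rule ell2_eqI) (simp add: pull.rep_eq plus_ell2.rep_eq)

lemma pull_scaleC: "pull \<sigma> (scaleC c x) = scaleC c (pull \<sigma> x)"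
  by (rule ell2_eqI) (simp add: pull.rep_eq scaleC.rep_eq)

lemma bounded_linear_push: "inj \<sigma> \<Longrightarrow> bounded_linear (push \<sigma>)"
  by (rule bounded_linear_intro[of _ 1])
    (auto simp: push_add push_scaleC scaleR_ell2_def norm_push)

lemma bounded_linear_pull: "inj \<sigma> \<Longrightarrow> bounded_linear (pull \<sigma>)"
  by (rule bounded_linear_intro[of _ 1])
    (auto simp: pull_add pull_scaleC scaleR_ell2_def norm_pull_le)

section \<open>Associativity and right creation operators\<close>

text \<open>Both sides sum \<open>\<phi>(f) \<psi>(k) \<eta>(g)\<close> over the factorizations \<open>h = fkg\<close>. The vectors \<open>a\<close> and \<open>b\<close>
  stand for \<open>\<phi> \<otimes> \<psi>\<close> and \<open>\<psi> \<otimes> \<eta>\<close> in whatever way these are known to be square-summable.\<close>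
lemma fock_coeff_assoc:
  assumes a: "\<And>h. Rep_ell2 a h = fock_coeff \<phi> \<psi> h"
    and b: "\<And>h. Rep_ell2 b h = fock_coeff \<psi> \<eta> h"
  shows "fock_coeff a \<eta> h = fock_coeff \<phi> b h"
proof -
  let ?S = "\<lambda>h. {(f, g). f @ g = (h :: 'a list)}"
  have "fock_coeff a \<eta> h = (\<Sum>x\<in>?S h. \<Sum>y\<in>?S (fst x).
      Rep_ell2 \<phi> (fst y) * Rep_ell2 \<psi> (snd y) * Rep_ell2 \<eta> (snd x))"
    unfolding fock_coeff_Rep[of a] a unfolding fock_coeff_Rep
    by (simp add: case_prod_unfold sum_distrib_right)
  also have "\<dots> = (\<Sum>z\<in>(SIGMA x:?S h. ?S (fst x)).
      Rep_ell2 \<phi> (fst (snd z)) * Rep_ell2 \<psi> (snd (snd z)) * Rep_ell2 \<eta> (snd (fst z)))"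
    by (subst sum.Sigma) (auto simp: finite_splits[unfolded case_prod_unfold] case_prod_unfold)
  also have "\<dots> = (\<Sum>z\<in>(SIGMA x:?S h. ?S (snd x)).
      Rep_ell2 \<phi> (fst (fst z)) * (Rep_ell2 \<psi> (fst (snd z)) * Rep_ell2 \<eta> (snd (snd z))))"
    by (rule sum.reindex_bij_witness[where
        i = "\<lambda>z. ((fst (fst z) @ fst (snd z), snd (snd z)), (fst (fst z), fst (snd z)))" and
        j = "\<lambda>z. ((fst (snd z), snd (snd z) @ snd (fst z)), (snd (snd z), snd (fst z)))"]) auto
  also have "\<dots> = (\<Sum>x\<in>?S h. \<Sum>y\<in>?S (snd x).
      Rep_ell2 \<phi> (fst x) * (Rep_ell2 \<psi> (fst y) * Rep_ell2 \<eta> (snd y)))"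
    by (subst sum.Sigma) (auto simp: finite_splits[unfolded case_prod_unfold] case_prod_unfold)
  also have "\<dots> = fock_coeff \<phi> b h"
    unfolding fock_coeff_Rep[of \<phi> b] b unfolding fock_coeff_Rep
    by (simp add: case_prod_unfold sum_distrib_left)
  finally show ?thesis .
qed

lemma Rep_ftimes:
  assumes "\<phi> \<in> F_inf \<or> \<psi> \<in> polys"
  shows "Rep_ell2 (\<phi> \<otimes> \<psi>) h = fock_coeff \<phi> \<psi> h"
  using cinner_ftimes[OF assms, of h] by (simp add: cinner_ket fock_coeff_Rep)

lemma inj_append_right: "inj (\<lambda>h. h @ g)" by (simp add: inj_def)

lemma Rep_push_append_right: "Rep_ell2 (push (\<lambda>h. h @ g) \<psi>) h = fock_coeff \<psi> (ket g) h"
proof (cases "\<exists>f. f @ g = h")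
  case True
  then obtain f where f: "h = f @ g" by blast
  show ?thesis
    using Rep_push[OF inj_append_right, of g \<psi> f] unfolding f by (simp add: fock_coeff_ket)
next
  case False
  then show ?thesis using Rep_push_outside[of h "\<lambda>h. h @ g"] by (auto simp: fock_coeff_ket)
qed

lemma ftimes_push_append_right:
  assumes "\<phi> \<in> F_inf"
  shows "\<phi> \<otimes> push (\<lambda>h. h @ g) \<psi> = push (\<lambda>h. h @ g) (\<phi> \<otimes> \<psi>)"
proof (rule ell2_eqI)
  fix h
  have "fock_coeff (\<phi> \<otimes> \<psi>) (ket g) h = fock_coeff \<phi> (push (\<lambda>h. h @ g) \<psi>) h"
    using assms by (intro fock_coeff_assoc[where \<psi> = \<psi>]) (simp_all add: Rep_ftimes Rep_push_append_right)
  then show "Rep_ell2 (\<phi> \<otimes> push (\<lambda>h. h @ g) \<psi>) h = Rep_ell2 (push (\<lambda>h. h @ g) (\<phi> \<otimes> \<psi>)) h"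
    using assms by (simp add: Rep_ftimes Rep_push_append_right)
qed

definition right_creation :: "'n \<Rightarrow> 'n fock \<Rightarrow> 'n fock" where
  "right_creation i = push (\<lambda>h. h @ [i])"

lemma right_creation_ket: "right_creation i (ket f) = ket (f @ [i])"
  by (simp add: right_creation_def push_ket[OF inj_append_right])

lemma bounded_linear_right_creation: "bounded_linear (right_creation i)"
  unfolding right_creation_def by (rule bounded_linear_push[OF inj_append_right])

lemma right_creation_add: "right_creation i (x + y) = right_creation i x + right_creation i y"
  by (simp add: right_creation_def push_add)

lemma right_creation_scaleC: "right_creation i (scaleC c x) = scaleC c (right_creation i x)"
  by (simp add: right_creation_def push_scaleC)

lemma right_creation_diff: "right_creation i (x - y) = right_creation i x - right_creation i y"
  by (rule linear_diff[OF bounded_linear.linear[OF bounded_linear_right_creation]])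

lemma norm_right_creation: "norm (right_creation i x) = norm x"
  by (simp add: right_creation_def norm_push[OF inj_append_right])

lemma Rep_right_creation_snoc:
  "Rep_ell2 (right_creation i x) (v @ [j]) = (if j = i then Rep_ell2 x v else 0)"
  using Rep_push[OF inj_append_right, of "[i]" x v] Rep_push_outside[of "v @ [j]" "\<lambda>h. h @ [i]" x]
  by (auto simp: right_creation_def)

lemma Rep_right_creation_Nil: "Rep_ell2 (right_creation i x) [] = 0"
  by (auto simp: right_creation_def intro: Rep_push_outside)

lemma norm_resolvent_ge:
  assumes "0 \<le> s" "s \<le> 1/2"
  shows "norm x / 2 \<le> norm (s *\<^sub>R x - right_creation i x)"
proof -
  have "s * norm x \<le> (1/2) * norm x" using assms by (intro mult_right_mono) auto
  then show ?thesis
    using norm_triangle_ineq2[of "right_creation i x" "s *\<^sub>R x"] assms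
    by (simp add: norm_right_creation norm_minus_commute)
qed

text \<open>The right creation operator \<open>R\<close> is a pure isometry. On words not ending in \<open>i\<close>,
  \<open>y = s h - R h\<close> says \<open>y(v) = s h(v)\<close> with \<open>h\<close> bounded as \<open>s\<close> tends to zero, so \<open>y(v) = 0\<close> and then \<open>h(v) = 0\<close>; the
  term \<open>R h\<close> therefore vanishes on words one letter longer, and the argument propagates.\<close>
lemma ranges_of_resolvents_meet_trivially:
  fixes y :: "'n fock"
  assumes "\<And>s. 0 < s \<Longrightarrow> s \<le> 1/2 \<Longrightarrow> \<exists>h. y = s *\<^sub>R h - right_creation i h"
  shows "y = 0"
proof -
  obtain h where h: "\<And>s. 0 < s \<Longrightarrow> s \<le> 1/2 \<Longrightarrow> y = s *\<^sub>R h s - right_creation i (h s)"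
    using assms by metis
  have h_le: "norm (h s) \<le> 2 * norm y" if "0 < s" "s \<le> 1/2" for s
    using norm_resolvent_ge[of s "h s" i] h[OF that] that by simp
  have Rep_y: "Rep_ell2 y v = s * Rep_ell2 (h s) v - Rep_ell2 (right_creation i (h s)) v"
    if "0 < s" "s \<le> 1/2" for s v
    using arg_cong[OF h[OF that], of "\<lambda>x. Rep_ell2 x v"]
    by (simp add: Rep_ell2_diff scaleR_ell2_def scaleC.rep_eq)
  have vanish: "Rep_ell2 y v = 0 \<and> (\<forall>s. 0 < s \<longrightarrow> s \<le> 1/2 \<longrightarrow> Rep_ell2 (h s) v = 0)"
    if "\<And>s. 0 < s \<Longrightarrow> s \<le> 1/2 \<Longrightarrow> Rep_ell2 (right_creation i (h s)) v = 0" for v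
  proof -
    have eq: "Rep_ell2 y v = s * Rep_ell2 (h s) v" if "0 < s" "s \<le> 1/2" for s
      using Rep_y[of s v] that \<open>\<And>s. 0 < s \<Longrightarrow> s \<le> 1/2 \<Longrightarrow> Rep_ell2 (right_creation i (h s)) v = 0\<close>
      by simp
    have le: "cmod (Rep_ell2 y v) \<le> s * (2 * norm y)" if "0 < s" "s \<le> 1/2" for s
      using eq[OF that] that ell2_coeff_le[of "h s" v] h_le[OF that]
      by (simp add: norm_mult)
    have "\<forall>\<^sub>F s in at_right (0::real). s \<in> {0<..<1/2}"
      by (rule eventually_at_right_real) simp
    then have "\<forall>\<^sub>F s in at_right (0::real). cmod (Rep_ell2 y v) \<le> s * (2 * norm y)"
      by eventually_elim (auto intro: le)
    moreover have "((\<lambda>s. s * (2 * norm y)) \<longlongrightarrow> 0 * (2 * norm y)) (at_right 0)"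
      by (intro tendsto_intros)
    ultimately have "cmod (Rep_ell2 y v) \<le> 0 * (2 * norm y)"
      by (intro tendsto_lowerbound[of "\<lambda>s. s * (2 * norm y)"]) auto
    then show ?thesis using eq by fastforce
  qed
  have "Rep_ell2 y v = 0 \<and> (\<forall>s. 0 < s \<longrightarrow> s \<le> 1/2 \<longrightarrow> Rep_ell2 (h s) v = 0)" for v
  proof (induction v rule: rev_induct)
    case Nil
    show ?case by (rule vanish) (simp add: Rep_right_creation_Nil)
  next
    case (snoc j v)
    then show ?case by (intro vanish) (simp add: Rep_right_creation_snoc)
  qed
  then show "y = 0" by (intro ell2_eqI) (simp add: zero_ell2.rep_eq)
qed

section \<open>Reflexivity of the algebra of all analytic Toeplitz operators\<close>

lemma bounded_ops_scaleC: "A \<in> bounded_ops \<Longrightarrow> blinfun_apply A (scaleC c x) = scaleC c (blinfun_apply A x)"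
  unfolding bounded_ops_def Vector_Spaces.linear_def module_hom_def module_hom_axioms_def by simp

lemma resolvent_range_in_Lat:
  assumes s: "0 \<le> s" "s \<le> 1/2"
  shows "range (\<lambda>\<psi>. s *\<^sub>R \<psi> - right_creation i \<psi>) \<in> Lat (fock_op ` F_inf)"
proof -
  let ?T = "\<lambda>\<psi>. s *\<^sub>R \<psi> - right_creation i \<psi>"
  have lin: "bounded_linear ?T"
    by (intro bounded_linear_sub bounded_linear_scaleR_right bounded_linear_right_creation)
  have sc: "?T (scaleC c \<psi>) = scaleC c (?T \<psi>)" for c \<psi>
    unfolding scaleR_ell2_def right_creation_scaleC cvec.scale_right_diff_distrib cvec.scale_scale
    by (simp add: mult.commute)
  have "\<forall>\<psi>\<in>UNIV. 1/2 * norm \<psi> \<le> norm (?T \<psi>)"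
    using norm_resolvent_ge[OF s, of _ i] by simp
  then have "complete (range ?T)"
    by (intro complete_isometric_image[of "1/2", OF _ subspace_UNIV lin] complete_UNIV) simp
  then have "closed (range ?T)" by (rule complete_imp_closed)
  moreover have "cvec.subspace (range ?T)"
  proof (rule cvec.subspaceI)
    show "0 \<in> range ?T"
      using rangeI[of ?T 0] by (simp add: linear_0[OF bounded_linear.linear[OF bounded_linear_right_creation]])
    show "x + y \<in> range ?T" if "x \<in> range ?T" "y \<in> range ?T" for x y
    proof -
      from that obtain \<psi> \<eta> where "x = ?T \<psi>" "y = ?T \<eta>" by blast
      then have "x + y = ?T (\<psi> + \<eta>)" by (simp add: right_creation_add scaleR_add_right)
      then show ?thesis by blast
    qed
    show "scaleC c x \<in> range ?T" if "x \<in> range ?T" for c x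
    proof -
      from that obtain \<psi> where "x = ?T \<psi>" by blast
      then have "scaleC c x = ?T (scaleC c \<psi>)" using sc by simp
      then show ?thesis by blast
    qed
  qed
  moreover have "blinfun_apply (fock_op \<phi>) ` range ?T \<subseteq> range ?T" if \<phi>: "\<phi> \<in> F_inf" for \<phi>
  proof -
    have "\<phi> \<otimes> ?T \<psi> = ?T (\<phi> \<otimes> \<psi>)" for \<psi>
      unfolding linear_diff[OF bounded_linear.linear[OF bounded_linear_ftimes(1)[OF \<phi>]]]
        linear_scale[OF bounded_linear.linear[OF bounded_linear_ftimes(1)[OF \<phi>]]]
        right_creation_def ftimes_push_append_right[OF \<phi>] ..
    then show ?thesis unfolding fock_op_apply[OF \<phi>] by blast
  qed
  ultimately show ?thesis unfolding Lat_def Lat_op_def by blast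
qed

text \<open>Invariance of \<open>range R\<close> gives \<open>A R \<psi> = R \<tau>\<close>, and invariance of \<open>range (s - R)\<close> then places
  \<open>R \<tau> - R A \<psi>\<close> in the range of \<open>s - R\<close> for every small \<open>s\<close>.\<close>
lemma Alg_Lat_commutes_right_creation:
  assumes "A \<in> Alg (Lat (fock_op ` F_inf))"
  shows "blinfun_apply A (right_creation i \<psi>) = right_creation i (blinfun_apply A \<psi>)"
proof -
  have A: "A \<in> bounded_ops" using assms by (simp add: Alg_def)
  have inv: "\<exists>g. blinfun_apply A (s *\<^sub>R \<eta> - right_creation i \<eta>) = s *\<^sub>R g - right_creation i g"
    if "0 \<le> s" "s \<le> 1/2" for s \<eta>
    using assms resolvent_range_in_Lat[OF that, of i] unfolding Alg_def Lat_op_def by blast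
  obtain \<tau> where \<tau>: "blinfun_apply A (right_creation i \<psi>) = right_creation i \<tau>"
    using inv[of 0 \<psi>] by (auto simp: blinfun.minus_right)
  have "right_creation i (blinfun_apply A \<psi> - \<tau>) = 0"
  proof (rule ranges_of_resolvents_meet_trivially)
    fix s :: real assume "0 < s" "s \<le> 1/2"
    then obtain g where "blinfun_apply A (s *\<^sub>R \<psi> - right_creation i \<psi>) = s *\<^sub>R g - right_creation i g"
      using inv[of s \<psi>] by auto
    then have "s *\<^sub>R blinfun_apply A \<psi> - right_creation i \<tau> = s *\<^sub>R g - right_creation i g"
      by (simp add: blinfun.diff_right blinfun.scaleR_right \<tau>)
    then have "right_creation i (blinfun_apply A \<psi> - \<tau>)
      = s *\<^sub>R (g - blinfun_apply A \<psi>) - right_creation i (g - blinfun_apply A \<psi>)"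
      by (simp add: right_creation_diff algebra_simps)
    then show "\<exists>h. right_creation i (blinfun_apply A \<psi> - \<tau>) = s *\<^sub>R h - right_creation i h" by blast
  qed
  then show ?thesis by (simp add: \<tau> right_creation_diff)
qed

text \<open>Commutation fixes \<open>A\<close> on the basis, so \<open>A p = \<phi> \<otimes> p\<close> with \<open>\<phi> = A e\<^sub>0\<close> for polynomials \<open>p\<close>. The
  boundedness of \<open>A\<close> then says \<open>\<phi> \<in> F_inf\<close>, after which density gives \<open>A \<psi> = \<phi> \<otimes> \<psi>\<close> for all \<open>\<psi>\<close>.\<close>
lemma operator_commuting_with_right_creations:
  assumes A: "A \<in> bounded_ops"
    and comm: "\<And>i \<psi>. blinfun_apply A (right_creation i \<psi>) = right_creation i (blinfun_apply A \<psi>)"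
  shows "A \<in> fock_op ` F_inf"
proof -
  define \<phi> where "\<phi> = blinfun_apply A (ket [])"
  have A_ket: "blinfun_apply A (ket f) = push (\<lambda>h. h @ f) \<phi>" for f
  proof (induction f rule: rev_induct)
    case Nil
    show ?case by (rule ell2_eqI) (simp add: \<phi>_def Rep_push[of "\<lambda>h. h"])
  next
    case (snoc i f)
    show ?case
    proof (rule ell2_eqI)
      fix h
      have "Rep_ell2 (blinfun_apply A (ket (f @ [i]))) h
          = Rep_ell2 (push (\<lambda>h. h @ [i]) (push (\<lambda>h. h @ f) \<phi>)) h"
        using snoc by (simp add: right_creation_ket[symmetric] comm) (simp add: right_creation_def)
      also have "\<dots> = fock_coeff (push (\<lambda>h. h @ f) \<phi>) (ket [i]) h"
        by (rule Rep_push_append_right)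
      also have "\<dots> = fock_coeff \<phi> (ket (f @ [i])) h"
        by (rule fock_coeff_assoc[OF Rep_push_append_right])
          (simp add: Rep_push_append_right[symmetric] push_ket[OF inj_append_right])
      finally show "Rep_ell2 (blinfun_apply A (ket (f @ [i]))) h
          = Rep_ell2 (push (\<lambda>h. h @ f @ [i]) \<phi>) h"
        by (simp add: Rep_push_append_right)
    qed
  qed
  have A_poly: "\<phi> \<otimes> p = blinfun_apply A p" if p: "p \<in> polys" for p
  proof (rule ell2_eqI)
    fix h
    have "fock_coeff \<phi> p h = Rep_ell2 (blinfun_apply A p) h"
      using p unfolding polys_def
    proof (induction rule: cvec.span_induct_alt)
      case base
      show ?case using fock_coeff_scaleC[of \<phi> 0 0 h] by (simp add: zero_ell2.rep_eq)
    next
      case (step c x y)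
      then show ?case
        by (auto simp: fock_coeff_add fock_coeff_scaleC blinfun.add_right bounded_ops_scaleC[OF A]
            plus_ell2.rep_eq scaleC.rep_eq A_ket Rep_push_append_right)
    qed
    then show "Rep_ell2 (\<phi> \<otimes> p) h = Rep_ell2 (blinfun_apply A p) h"
      by (simp add: Rep_ftimes p)
  qed
  have "norm_inf \<phi> \<le> ereal (norm A)"
    unfolding norm_inf_def
  proof (rule SUP_least)
    fix p :: "'a fock" assume p: "p \<in> {p \<in> polys. norm p \<le> 1}"
    then have "norm (blinfun_apply A p) \<le> norm A * 1"
      by (intro order_trans[OF norm_blinfun] mult_left_mono) auto
    then show "ereal (norm (\<phi> \<otimes> p)) \<le> ereal (norm A)" using p by (simp add: A_poly)
  qed
  then have \<phi>: "\<phi> \<in> F_inf" by (auto simp: F_inf_def)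
  have "\<psi> \<in> {\<psi>. blinfun_apply A \<psi> = \<phi> \<otimes> \<psi>}" for \<psi>
  proof (rule closed_subspace_containing_kets)
    show "cvec.subspace {\<psi>. blinfun_apply A \<psi> = \<phi> \<otimes> \<psi>}"
      using bounded_linear_ftimes[OF \<phi>]
      by (intro cvec.subspaceI)
        (auto simp: blinfun.add_right bounded_ops_scaleC[OF A] linear_add linear_0 dest!: bounded_linear.linear)
    show "closed {\<psi>. blinfun_apply A \<psi> = \<phi> \<otimes> \<psi>}"
      by (intro closed_Collect_eq blinfun.continuous_on continuous_on_id continuous_on_const
          bounded_linear.continuous_on[OF bounded_linear_ftimes(1)[OF \<phi>]])
    show "ket f \<in> {\<psi>. blinfun_apply A \<psi> = \<phi> \<otimes> \<psi>}" for f
      by (simp add: A_poly polys_def cvec.span_base)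
  qed
  then have "A = fock_op \<phi>" by (intro blinfun_eqI) (simp add: fock_op_apply[OF \<phi>])
  with \<phi> show ?thesis by blast
qed

lemma Alg_Lat_F_inf: "A \<in> Alg (Lat (fock_op ` F_inf)) \<Longrightarrow> A \<in> fock_op ` F_inf"
  by (rule operator_commuting_with_right_creations)
    (auto simp: Alg_Lat_commutes_right_creation, simp add: Alg_def)

section \<open>Columns of Fock vectors and wandering vectors\<close>

text \<open>A family of vectors of the Fock space indexed by \<open>'k\<close> is treated as one vector whose index
  set consists of the pairs of a word and an index; the left creation operators act on all
  components at once.\<close>
definition left_shift :: "'n list \<Rightarrow> ('n list \<times> 'k) ell2 \<Rightarrow> ('n list \<times> 'k) ell2" where
  "left_shift f = push (\<lambda>(h, j). (f @ h, j))"

definition component :: "'k \<Rightarrow> ('n list \<times> 'k) ell2 \<Rightarrow> 'n fock" where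
  "component j = pull (\<lambda>h. (h, j))"

lemma inj_left_shift: "inj (\<lambda>(h :: 'n list, j :: 'k). (f @ h, j))"
  by (auto simp: inj_def)

lemma inj_component: "inj (\<lambda>h. (h, j))"
  by (auto simp: inj_def)

lemma Rep_component: "Rep_ell2 (component j x) h = Rep_ell2 x (h, j)"
  by (simp add: component_def Rep_pull[OF inj_component])

lemma Rep_left_shift: "Rep_ell2 (left_shift f x) (f @ h, j) = Rep_ell2 x (h, j)"
  using Rep_push[OF inj_left_shift, of f x "(h, j)"] by (simp add: left_shift_def)

lemma Rep_left_shift_outside:
  "(\<And>g. h \<noteq> f @ g) \<Longrightarrow> Rep_ell2 (left_shift f x) (h, j) = 0"
  unfolding left_shift_def by (rule Rep_push_outside) auto

lemma left_shift_Nil: "left_shift [] x = x"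
  by (rule ell2_eqI) (metis Rep_left_shift append_Nil surj_pair)

lemma left_shift_left_shift: "left_shift f (left_shift g x) = left_shift (f @ g) x"
proof (rule ell2_eqI, clarify)
  fix h j
  consider k where "h = f @ g @ k" | k where "h = f @ k" "\<And>l. k \<noteq> g @ l" | "\<And>k. h \<noteq> f @ k"
    by blast
  then show "Rep_ell2 (left_shift f (left_shift g x)) (h, j) = Rep_ell2 (left_shift (f @ g) x) (h, j)"
  proof cases
    case 1
    then show ?thesis using Rep_left_shift[of "f @ g" x k j] by (simp add: Rep_left_shift)
  next
    case 2
    then show ?thesis by (simp add: Rep_left_shift Rep_left_shift_outside)
  next
    case 3
    then show ?thesis by (simp add: Rep_left_shift_outside)
  qed
qed

lemma bounded_linear_left_shift: "bounded_linear (left_shift f)"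
  unfolding left_shift_def by (rule bounded_linear_push[OF inj_left_shift])

lemma left_shift_scaleC: "left_shift f (scaleC c x) = scaleC c (left_shift f x)"
  by (simp add: left_shift_def push_scaleC)

lemma cinner_left_shift: "cinner (left_shift f x) (left_shift f y) = cinner x y"
  by (simp add: left_shift_def cinner_push[OF inj_left_shift] pull_push[OF inj_left_shift])

lemma cinner_left_shift_incomparable:
  assumes "\<And>u v. f @ u \<noteq> g @ v"
  shows "cinner (left_shift f x) (left_shift g y) = 0"
proof -
  have "Rep_ell2 (left_shift f x) (h, j) * cnj (Rep_ell2 (left_shift g y) (h, j)) = 0" for h j
    using assms Rep_left_shift_outside[of h f x j] Rep_left_shift_outside[of h g y j]
    by (cases "\<exists>u. h = f @ u") auto
  then have "Rep_ell2 (left_shift f x) i * cnj (Rep_ell2 (left_shift g y) i) = 0" for i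
    by (cases i) blast
  then show ?thesis by (simp only: cinner.rep_eq infsum_0)
qed

lemma fock_coeff_add_left: "fock_coeff (x + y) \<psi> h = fock_coeff x \<psi> h + fock_coeff y \<psi> h"
  by (simp add: fock_coeff_Rep plus_ell2.rep_eq distrib_right sum.distrib case_prod_unfold)

lemma fock_coeff_diff_left: "fock_coeff (x - y) \<psi> h = fock_coeff x \<psi> h - fock_coeff y \<psi> h"
  by (simp add: fock_coeff_Rep Rep_ell2_diff left_diff_distrib sum_subtractf case_prod_unfold)

lemma fock_coeff_scaleC_left: "fock_coeff (scaleC c x) \<psi> h = c * fock_coeff x \<psi> h"
  by (simp add: fock_coeff_Rep scaleC.rep_eq sum_distrib_left case_prod_unfold mult.assoc)

lemma fock_coeff_component:
  assumes G: "finite G" "fst ` {(f, g). f @ g = h} \<subseteq> G"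
  shows "fock_coeff \<psi> (component j w) h
    = (\<Sum>f\<in>G. Rep_ell2 \<psi> f * Rep_ell2 (left_shift f w) (h, j))"
proof -
  let ?S = "{(f, g). f @ g = h}"
  have "fock_coeff \<psi> (component j w) h
      = (\<Sum>x\<in>?S. Rep_ell2 \<psi> (fst x) * Rep_ell2 (left_shift (fst x) w) (h, j))"
    unfolding fock_coeff_Rep by (rule sum.cong) (auto simp: Rep_component Rep_left_shift)
  also have "\<dots> = (\<Sum>f\<in>fst ` ?S. Rep_ell2 \<psi> f * Rep_ell2 (left_shift f w) (h, j))"
    by (subst sum.reindex) (auto simp: inj_on_def)
  also have "\<dots> = (\<Sum>f\<in>G. Rep_ell2 \<psi> f * Rep_ell2 (left_shift f w) (h, j))"
  proof (rule sum.mono_neutral_left[OF G], clarify)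
    fix f assume "f \<notin> fst ` ?S"
    then have "\<And>g. h \<noteq> f @ g" by force
    then have "Rep_ell2 (left_shift f w) (h, j) = 0" by (rule Rep_left_shift_outside)
    then show "Rep_ell2 \<psi> f * Rep_ell2 (left_shift f w) (h, j) = 0" by simp
  qed
  finally show ?thesis .
qed

lemma cinner_ket_ket: "cinner (ket f) (ket g) = (if f = g then 1 else 0)"
  by (simp add: cinner_ket ket.rep_eq)

lemma norm_sum_orthogonal:
  assumes orth: "\<And>f g. cinner (b f) (b g) = (if f = g then of_real r else 0)"
  shows "(norm (\<Sum>f\<in>F. scaleC (c f) (b f)))\<^sup>2 = r * (\<Sum>f\<in>F. (cmod (c f))\<^sup>2)"
proof (cases "finite F")
  case True
  let ?y = "\<Sum>f\<in>F. scaleC (c f) (b f)"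
  have "complex_of_real ((norm ?y)\<^sup>2) = (\<Sum>f\<in>F. \<Sum>g\<in>F. cnj (c f) * (c g * cinner (b g) (b f)))"
    by (simp only: cinner_self_ell2[symmetric] cinner_sum_left cinner_sum_right
        cinner_scaleC_left_ell2 cinner_scaleC_right sum_distrib_left)
  also have "\<dots> = (\<Sum>f\<in>F. c f * (cnj (c f) * of_real r))"
    by (simp add: orth mult.left_commute if_distrib[of "\<lambda>z. _ * z"] True cong: if_cong)
  also have "\<dots> = complex_of_real (r * (\<Sum>f\<in>F. (cmod (c f))\<^sup>2))"
    unfolding of_real_mult of_real_sum complex_norm_square sum_distrib_left by (simp add: ac_simps)
  finally show ?thesis unfolding of_real_eq_iff .
qed simp

text \<open>Right multiplication by a wandering vector \<open>w\<close> maps the orthonormal basis to the orthogonal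
  family of the translates of \<open>w\<close>. This makes it a contraction (an isometry or zero, in the case
  of interest).\<close>
locale wandering =
  fixes w :: "('n list \<times> 'k) ell2"
  assumes wandering: "f \<noteq> [] \<Longrightarrow> cinner (left_shift f w) w = 0"
    and norm_le_1: "norm w \<le> 1"
begin

lemma cinner_translates:
  "cinner (left_shift f w) (left_shift g w) = (if f = g then of_real ((norm w)\<^sup>2) else 0)"
proof -
  consider "f = g" | k where "k \<noteq> []" "f = g @ k" | k where "k \<noteq> []" "g = f @ k"
    | "\<And>u v. f @ u \<noteq> g @ v"
    unfolding append_eq_append_conv2 by (metis append_Nil2)
  then show ?thesis
  proof cases
    case 1
    then show ?thesis using cinner_left_shift[of g w w] cinner_self_ell2[of w] by simp
  next
    case 2
    then show ?thesis
      using wandering by (simp add: left_shift_left_shift[symmetric] cinner_left_shift)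
  next
    case 3
    then show ?thesis
      using wandering[of k] cinner_commute_ell2[of w "left_shift k w"]
      by (simp add: left_shift_left_shift[symmetric] cinner_left_shift)
  next
    case 4
    then show ?thesis by (auto simp: cinner_left_shift_incomparable)
  qed
qed

text \<open>The column \<open>\<psi> \<otimes> w\<close>. Its coefficients are square-summable because any finite number of them
  involves only finitely many coefficients of \<open>\<psi>\<close>, that is, a finite combination of orthogonal
  translates of \<open>w\<close>.\<close>
definition rmult :: "'n fock \<Rightarrow> ('n list \<times> 'k) ell2" where
  "rmult \<psi> = Abs_ell2 (\<lambda>(h, j). fock_coeff \<psi> (component j w) h)"

lemma rmult_partial_sums:
  assumes "finite W"
  shows "(\<Sum>i\<in>W. (cmod (case i of (h, j) \<Rightarrow> fock_coeff \<psi> (component j w) h))\<^sup>2) \<le> (norm \<psi>)\<^sup>2"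
proof -
  define G where "G = (\<Union>h\<in>fst ` W. fst ` {(f, g). f @ g = h})"
  have G: "finite G" unfolding G_def using assms finite_splits by blast
  define y where "y = (\<Sum>f\<in>G. scaleC (Rep_ell2 \<psi> f) (left_shift f w))"
  have "fock_coeff \<psi> (component j w) h = Rep_ell2 y (h, j)" if "(h, j) \<in> W" for h j
  proof -
    have "h \<in> fst ` W" using that by force
    then have "fst ` {(f, g). f @ g = h} \<subseteq> G" unfolding G_def by blast
    from fock_coeff_component[OF G this] show ?thesis
      by (simp add: y_def Rep_ell2_sum scaleC.rep_eq)
  qed
  then have "(\<Sum>i\<in>W. (cmod (case i of (h, j) \<Rightarrow> fock_coeff \<psi> (component j w) h))\<^sup>2)
      = (\<Sum>i\<in>W. (cmod (Rep_ell2 y i))\<^sup>2)"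
    by (intro sum.cong) auto
  also have "\<dots> \<le> (norm y)\<^sup>2" by (rule ell2_finite_sum_le[OF assms])
  also have "\<dots> = (norm w)\<^sup>2 * (\<Sum>f\<in>G. (cmod (Rep_ell2 \<psi> f))\<^sup>2)"
    unfolding y_def by (rule norm_sum_orthogonal[OF cinner_translates])
  also have "\<dots> \<le> 1 * (norm \<psi>)\<^sup>2"
    using norm_le_1 by (intro mult_mono ell2_finite_sum_le G) (auto simp: power_le_one sum_nonneg)
  finally show ?thesis by simp
qed

lemma Rep_rmult: "Rep_ell2 (rmult \<psi>) (h, j) = fock_coeff \<psi> (component j w) h"
  unfolding rmult_def using ell2_boundedI(1)[OF rmult_partial_sums] by (subst Abs_ell2_inverse) auto

lemma norm_rmult_le: "norm (rmult \<psi>) \<le> norm \<psi>"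
proof (rule power2_le_imp_le)
  show "(norm (rmult \<psi>))\<^sup>2 \<le> (norm \<psi>)\<^sup>2"
    unfolding rmult_def by (rule ell2_boundedI(2)[OF rmult_partial_sums])
qed simp

lemma rmult_add: "rmult (x + y) = rmult x + rmult y"
  by (rule ell2_eqI) (auto simp: Rep_rmult plus_ell2.rep_eq fock_coeff_add_left)

lemma rmult_scaleC: "rmult (scaleC c x) = scaleC c (rmult x)"
  by (rule ell2_eqI) (auto simp: Rep_rmult scaleC.rep_eq fock_coeff_scaleC_left)

lemma bounded_linear_rmult: "bounded_linear rmult"
  by (rule bounded_linear_intro[of _ 1])
    (auto simp: rmult_add rmult_scaleC scaleR_ell2_def norm_rmult_le)

lemma rmult_sum: "rmult (\<Sum>f\<in>F. x f) = (\<Sum>f\<in>F. rmult (x f))"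
  by (rule linear_sum[OF bounded_linear.linear[OF bounded_linear_rmult]])

lemma rmult_ket: "rmult (ket f) = left_shift f w"
proof (rule ell2_eqI, clarify)
  fix h j
  define G where "G = insert f (fst ` {(f, g). f @ g = h})"
  have "finite G" "fst ` {(f, g). f @ g = h} \<subseteq> G" "f \<in> G"
    unfolding G_def using finite_splits by auto
  then have "Rep_ell2 (rmult (ket f)) (h, j)
      = (\<Sum>f'\<in>G. if f' = f then Rep_ell2 (left_shift f w) (h, j) else 0)"
    unfolding Rep_rmult by (subst fock_coeff_component[of G]) (simp_all add: ket.rep_eq if_distrib[of "\<lambda>z. z * _"] cong: if_cong)
  also have "\<dots> = Rep_ell2 (left_shift f w) (h, j)"
    using \<open>finite G\<close> \<open>f \<in> G\<close> by simp
  finally show "Rep_ell2 (rmult (ket f)) (h, j) = Rep_ell2 (left_shift f w) (h, j)" .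
qed

lemma cinner_rmult_translate: "cinner (rmult \<psi>) (left_shift g w) = Rep_ell2 \<psi> g * of_real ((norm w)\<^sup>2)"
proof -
  have "\<psi> \<in> {\<psi>. cinner (rmult \<psi>) (left_shift g w) = Rep_ell2 \<psi> g * of_real ((norm w)\<^sup>2)}"
  proof (rule closed_subspace_containing_kets)
    show "cvec.subspace {\<psi>. cinner (rmult \<psi>) (left_shift g w) = Rep_ell2 \<psi> g * of_real ((norm w)\<^sup>2)}"
      using rmult_scaleC[of 0 0]
      by (intro cvec.subspaceI) (auto simp: rmult_add rmult_scaleC cinner_add_left_ell2
          cinner_scaleC_left_ell2 plus_ell2.rep_eq scaleC.rep_eq zero_ell2.rep_eq algebra_simps)
    show "closed {\<psi>. cinner (rmult \<psi>) (left_shift g w) = Rep_ell2 \<psi> g * of_real ((norm w)\<^sup>2)}"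
      by (intro closed_Collect_eq continuous_intros bounded_linear.continuous_on[OF bounded_linear_rmult])
    show "ket f \<in> {\<psi>. cinner (rmult \<psi>) (left_shift g w) = Rep_ell2 \<psi> g * of_real ((norm w)\<^sup>2)}" for f
      by (auto simp: rmult_ket cinner_translates ket.rep_eq)
  qed
  then show ?thesis by simp
qed

lemma rmult_in_closed_subspace:
  assumes "cvec.subspace M" "closed M" "\<And>f. left_shift f w \<in> M"
  shows "rmult \<psi> \<in> M"
proof -
  have "\<psi> \<in> rmult -` M"
  proof (rule closed_subspace_containing_kets)
    show "cvec.subspace (rmult -` M)"
      using assms(1) rmult_scaleC[of 0 0]
      by (intro cvec.subspaceI)
        (auto simp: rmult_add rmult_scaleC cvec.subspace_0 cvec.subspace_add cvec.subspace_scale)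
    show "closed (rmult -` M)"
      by (rule closed_vimage[OF assms(2)]) (intro bounded_linear.continuous_on[OF bounded_linear_rmult] continuous_on_id)
    show "ket f \<in> rmult -` M" for f using assms(3) by (simp add: rmult_ket)
  qed
  then show ?thesis by simp
qed

text \<open>Bessel's inequality: pairing \<open>x\<close> with a finite partial sum \<open>t\<close> of the family of coefficients,
  transported by the contraction, gives \<open>\<parallel>t\<parallel>\<^sup>2 \<le> \<parallel>x\<parallel> \<parallel>t\<parallel>\<close>.\<close>
lemma fourier_coefficients:
  obtains u where "\<And>f. Rep_ell2 u f = cinner x (left_shift f w)"
proof -
  let ?c = "\<lambda>f. cinner x (left_shift f w)"
  have "(\<Sum>f\<in>F. (cmod (?c f))\<^sup>2) \<le> (norm x)\<^sup>2" for F
  proof -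
    define t where "t = (\<Sum>f\<in>F. scaleC (?c f) (ket f))"
    have t: "(norm t)\<^sup>2 = (\<Sum>f\<in>F. (cmod (?c f))\<^sup>2)"
      unfolding t_def by (subst norm_sum_orthogonal[where r = 1]) (auto simp: cinner_ket_ket)
    have "cinner x (rmult t) = (\<Sum>f\<in>F. cnj (?c f) * ?c f)"
      by (simp add: t_def rmult_sum rmult_scaleC rmult_ket cinner_sum_right cinner_scaleC_right)
    also have "\<dots> = of_real ((norm t)\<^sup>2)"
      unfolding t of_real_sum complex_norm_square by (simp add: mult.commute)
    finally have "(norm t)\<^sup>2 = inner x (rmult t)" by (simp add: inner_ell2_def)
    also have "\<dots> \<le> norm x * norm (rmult t)" by (rule norm_cauchy_schwarz)
    also have "\<dots> \<le> norm x * norm t" by (intro mult_left_mono norm_rmult_le) simp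
    finally have "norm t \<le> norm x" by (cases "t = 0") (simp_all add: power2_eq_square)
    then show ?thesis unfolding t[symmetric] by (intro power_mono) auto
  qed
  from ell2_boundedI(1)[OF this] show thesis
    by (intro that[of "Abs_ell2 ?c"]) (simp add: Abs_ell2_inverse)
qed

end

lemma closed_span_image_in:
  assumes T: "bounded_linear T" "\<And>c x. T (scaleC c x) = scaleC c (T x)"
    and S: "\<And>x. x \<in> S \<Longrightarrow> T x \<in> N" and N: "cvec.subspace N" "closed N" and x: "x \<in> closed_span S"
  shows "T x \<in> N"
proof -
  have "closed_span S \<subseteq> T -` N"
  proof (rule closed_span_minimal)
    show "S \<subseteq> T -` N" using S by blast
    show "cvec.subspace (T -` N)"
      using N(1) bounded_linear.linear[OF T(1)]
      by (intro cvec.subspaceI)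
        (auto simp: T(2) linear_0 linear_add cvec.subspace_0 cvec.subspace_add cvec.subspace_scale)
    show "closed (T -` N)"
      by (rule closed_vimage[OF N(2)]) (intro bounded_linear.continuous_on[OF T(1)] continuous_on_id)
  qed
  then show ?thesis using x by blast
qed

section \<open>A common left factor for finitely many Fock vectors\<close>

text \<open>Let \<open>M\<close> be the closed invariant subspace generated by \<open>x\<close>, and let \<open>N \<subseteq> M\<close> be generated by the
  proper translates of \<open>x\<close>. The component \<open>w\<close> of \<open>x\<close> orthogonal to \<open>N\<close> is wandering and
  \<open>M = \<complex>w + N\<close>. If \<open>y \<in> M\<close> is orthogonal to all translates of \<open>w\<close>, then \<open>y \<in> N\<close>, so \<open>y\<close> vanishes
  on the empty word, and deleting a first letter \<open>i\<close> gives a vector of \<open>M\<close> with the same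
  property; hence \<open>y = 0\<close>. Applied to \<open>y = x - u \<otimes> w\<close>, with \<open>u\<close> the Fourier coefficients of \<open>x\<close>, this
  yields \<open>x = u \<otimes> w\<close>.\<close>
lemma column_factorization:
  fixes x :: "('n list \<times> 'k) ell2"
  obtains w u where "wandering w" "x = wandering.rmult w u"
proof -
  define M where "M = closed_span (range (\<lambda>f. left_shift f x))"
  define N where "N = closed_span ((\<lambda>f. left_shift f x) ` {f. f \<noteq> []})"
  have sub: "cvec.subspace M" "closed M" "cvec.subspace N" "closed N"
    by (simp_all add: M_def N_def)
  have xM: "left_shift f x \<in> M" for f unfolding M_def by (rule closed_span_base) blast
  have xN: "left_shift f x \<in> N" if "f \<noteq> []" for f
    unfolding N_def by (rule closed_span_base) (use that in blast)
  have NM: "N \<subseteq> M" unfolding N_def by (rule closed_span_minimal) (use xM sub in auto)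
  have MN: "left_shift f y \<in> N" if "y \<in> M" "f \<noteq> []" for f y
    using bounded_linear_left_shift left_shift_scaleC _ sub(3,4) that(1)[unfolded M_def]
    by (rule closed_span_image_in) (use xN that(2) in \<open>auto simp: left_shift_left_shift\<close>)
  obtain n where n: "n \<in> N" "\<And>m. m \<in> N \<Longrightarrow> cinner (x - n) m = 0"
    using orthogonal_projection_exists[OF sub(3,4)] by blast
  define w0 where "w0 = x - n"
  \<comment> \<open>If \<open>x \<in> N\<close>, the convention \<open>inverse 0 = 0\<close> gives \<open>w = 0\<close>, which is what the argument needs.\<close>
  define w where "w = scaleC (of_real (inverse (norm w0))) w0"
  have w_M: "w \<in> M"
    unfolding w_def w0_def using n(1) NM xM[of "[]"] sub(1)
    by (intro cvec.subspace_scale cvec.subspace_diff) (auto simp: left_shift_Nil)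
  have w_N: "cinner m w = 0" if "m \<in> N" for m
    using n(2)[OF that] cinner_commute_ell2[of m w0]
    by (simp add: w_def cinner_scaleC_right w0_def)
  have norm_w: "norm w = (if w0 = 0 then 0 else 1)" by (simp add: w_def norm_scaleC norm_inverse)
  interpret wandering w
  proof
    show "cinner (left_shift f w) w = 0" if "f \<noteq> []" for f using MN[OF w_M that] by (rule w_N)
    show "norm w \<le> 1" by (simp add: norm_w)
  qed
  have decomp: "y - scaleC (cinner y w) w \<in> N" if "y \<in> M" for y
  proof -
    have "cinner x w = cinner w0 w"
      using w_N[OF n(1)] by (simp add: w0_def cinner_diff_left)
    also have "\<dots> = of_real (norm w0)"
      by (cases "w0 = 0") (simp_all add: w_def cinner_scaleC_right cinner_self_ell2 power2_eq_square)
    finally have "scaleC (cinner x w) w = w0" by (cases "w0 = 0") (simp_all add: w_def)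
    then have "x - scaleC (cinner x w) w = n" by (simp add: w0_def)
    then have "left_shift f x - scaleC (cinner (left_shift f x) w) w \<in> N" for f
      using n(1) xN[of f] w_N[OF xN, of f] by (cases "f = []") (simp_all add: left_shift_Nil)
    moreover have "bounded_linear (\<lambda>y. y - scaleC (cinner y w) w)"
    proof (rule bounded_linear_intro)
      fix y z :: "('n list \<times> 'k) ell2" and r :: real
      show "y + z - scaleC (cinner (y + z) w) w
          = y - scaleC (cinner y w) w + (z - scaleC (cinner z w) w)"
        by (simp add: cinner_add_left_ell2 cvec.scale_left_distrib)
      show "r *\<^sub>R y - scaleC (cinner (r *\<^sub>R y) w) w = r *\<^sub>R (y - scaleC (cinner y w) w)"
        by (simp add: scaleR_ell2_def cinner_scaleC_left_ell2 cvec.scale_right_diff_distrib)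
      have "cmod (cinner y w) \<le> norm y * (norm w + norm w)"
      proof -
        have "cmod (cinner y w) \<le> \<bar>inner y w\<bar> + \<bar>inner y (scaleC \<i> w)\<bar>"
          unfolding cinner_eq_inner by (rule order_trans[OF norm_triangle_ineq]) (simp add: norm_mult)
        also have "\<dots> \<le> norm y * norm w + norm y * norm (scaleC \<i> w)"
          by (intro add_mono Cauchy_Schwarz_ineq2)
        finally show ?thesis by (simp add: norm_scaleC algebra_simps)
      qed
      then have "norm (scaleC (cinner y w) w) \<le> (norm y * (norm w + norm w)) * norm w"
        unfolding norm_scaleC by (rule mult_right_mono) simp
      then show "norm (y - scaleC (cinner y w) w) \<le> norm y * (1 + (norm w + norm w) * norm w)"
        using norm_triangle_ineq4[of y "scaleC (cinner y w) w"] by (simp add: algebra_simps)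
    qed
    moreover have "scaleC c y - scaleC (cinner (scaleC c y) w) w
        = scaleC c (y - scaleC (cinner y w) w)" for c y
      by (simp add: cinner_scaleC_left_ell2 cvec.scale_right_diff_distrib)
    ultimately show ?thesis
      by (intro closed_span_image_in[where T = "\<lambda>y. y - scaleC (cinner y w) w", OF _ _ _ sub(3,4) that[unfolded M_def]])
        blast+
  qed
  have N_Nil: "Rep_ell2 y ([], j) = 0" if "y \<in> N" for y j
  proof -
    have "N \<subseteq> {y. Rep_ell2 y ([], j) = 0}"
      unfolding N_def
    proof (rule closed_span_minimal)
      show "(\<lambda>f. left_shift f x) ` {f. f \<noteq> []} \<subseteq> {y. Rep_ell2 y ([], j) = 0}"
        by (auto intro: Rep_left_shift_outside)
      show "cvec.subspace {y. Rep_ell2 y ([] :: 'n list, j) = 0}"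
        by (intro cvec.subspaceI) (auto simp: zero_ell2.rep_eq plus_ell2.rep_eq scaleC.rep_eq)
      show "closed {y. Rep_ell2 y ([] :: 'n list, j) = 0}"
        by (intro closed_Collect_eq continuous_intros)
    qed
    then show ?thesis using that by blast
  qed
  \<comment> \<open>The adjoint of \<open>left_shift [i]\<close>: it deletes a leading letter \<open>i\<close>.\<close>
  define del where "del = (\<lambda>i. pull (\<lambda>(h :: 'n list, j :: 'k). ([i] @ h, j)))"
  have Rep_del: "Rep_ell2 (del i y) (h, j) = Rep_ell2 y (i # h, j)" for i y h j
    using Rep_pull[OF inj_left_shift, of "[i]" y "(h, j)"] by (simp add: del_def)
  have cinner_del: "cinner (del i y) (left_shift f w) = cinner y (left_shift (i # f) w)" for i y f
  proof -
    have "cinner (left_shift [i] (left_shift f w)) y = cinner (left_shift f w) (del i y)"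
      unfolding del_def left_shift_def[of "[i]"] by (rule cinner_push[OF inj_left_shift])
    then show ?thesis
      using cinner_commute_ell2[of y "left_shift (i # f) w"] cinner_commute_ell2[of "del i y" "left_shift f w"]
      by (simp add: left_shift_left_shift)
  qed
  have del_M: "del i y \<in> M" if "y \<in> N" for i y
  proof (rule closed_span_image_in[of "del i"])
    show "bounded_linear (del i)" unfolding del_def by (rule bounded_linear_pull[OF inj_left_shift])
    show "del i (scaleC c y) = scaleC c (del i y)" for c y by (simp add: del_def pull_scaleC)
    show "y \<in> closed_span ((\<lambda>f. left_shift f x) ` {f. f \<noteq> []})" using that by (simp add: N_def)
    fix z assume "z \<in> (\<lambda>f. left_shift f x) ` {f. f \<noteq> []}"
    then obtain i' f where z: "z = left_shift (i' # f) x" by (auto simp: neq_Nil_conv)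
    show "del i z \<in> M"
    proof (cases "i' = i")
      case True
      then have "z = left_shift [i] (left_shift f x)" by (simp add: z left_shift_left_shift)
      then have "del i z = left_shift f x"
        unfolding left_shift_def[of "[i]"] del_def by (simp only: pull_push[OF inj_left_shift, of "[i]"])
      then show ?thesis using xM by simp
    next
      case False
      then have "del i z = 0"
        by (intro ell2_eqI) (auto simp: Rep_del z zero_ell2.rep_eq intro!: Rep_left_shift_outside)
      then show ?thesis using sub(1) by (simp add: cvec.subspace_0)
    qed
  qed (use sub in auto)
  have zero: "Rep_ell2 y (h, j) = 0" if "y \<in> M" "\<And>f. cinner y (left_shift f w) = 0" for y h j
    using that
  proof (induction h arbitrary: y)
    case (Nil y)
    then have "y \<in> N" using decomp[of y] Nil.prems(2)[of "[]"] by (simp add: left_shift_Nil)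
    then show ?case by (rule N_Nil)
  next
    case (Cons i h y)
    then have "y \<in> N" using decomp[of y] Cons.prems(2)[of "[]"] by (simp add: left_shift_Nil)
    then have "Rep_ell2 (del i y) (h, j) = 0"
      using Cons by (intro Cons.IH del_M) (auto simp: cinner_del)
    then show ?case by (simp add: Rep_del)
  qed
  obtain u where u: "\<And>f. Rep_ell2 u f = cinner x (left_shift f w)" using fourier_coefficients[where x = x] by blast
  have "left_shift f w \<in> M" for f
    using MN[OF w_M, of f] NM w_M by (cases "f = []") (auto simp: left_shift_Nil)
  then have "x - rmult u \<in> M"
    using sub(1,2) xM[of "[]"] by (intro cvec.subspace_diff rmult_in_closed_subspace) (auto simp: left_shift_Nil)
  moreover have "cinner (x - rmult u) (left_shift f w) = 0" for f
  proof (cases "w0 = 0")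
    case True
    then have "w = 0" by (simp add: w_def)
    then have "left_shift f w = 0" using left_shift_scaleC[of f 0 w] by simp
    then show ?thesis by simp
  next
    case False
    then show ?thesis by (simp add: cinner_diff_left cinner_rmult_translate u norm_w)
  qed
  ultimately have "x - rmult u = 0" by (intro ell2_eqI) (auto simp: zero zero_ell2.rep_eq)
  then show thesis using wandering_axioms by (intro that) auto
qed

text \<open>The family is assembled into one column, and \<open>w j\<close> is the \<open>j\<close>-th component of its wandering
  vector. The second conclusion makes the products \<open>\<psi> \<otimes> w j\<close> meaningful: here \<open>w j\<close> is seldom a
  polynomial and \<open>\<psi>\<close> is arbitrary, so that their coefficients are square-summable only because
  \<open>w j\<close> comes from a wandering vector.\<close>
lemma common_left_factor:
  fixes x :: "'k \<Rightarrow> 'n fock"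
  assumes J: "finite J"
  obtains u w where "\<And>j. j \<in> J \<Longrightarrow> x j = u \<otimes> w j"
    and "\<And>j \<psi> h. Rep_ell2 (\<psi> \<otimes> w j) h = fock_coeff \<psi> (w j) h"
    and "\<And>j \<psi>. norm (\<psi> \<otimes> w j) \<le> norm \<psi>"
proof -
  define c where "c = (\<Sum>j\<in>J. push (\<lambda>h. (h, j)) (x j))"
  have Rep_col: "Rep_ell2 (push (\<lambda>h. (h, k)) y) (h, j) = (if k = j then Rep_ell2 y h else 0)"
    for h j k and y :: "'n fock"
    using Rep_push[OF inj_component, of j y h] Rep_push_outside[of "(h, j)" "\<lambda>h. (h, k)" y] by auto
  have c: "component j c = x j" if "j \<in> J" for j
    using that J by (intro ell2_eqI) (simp add: Rep_component c_def Rep_ell2_sum Rep_col)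
  obtain w u where w: "wandering w" and cu: "c = wandering.rmult w u"
    by (rule column_factorization)
  interpret wandering w by (rule w)
  have comp: "\<psi> \<otimes> component j w = component j (rmult \<psi>)" for \<psi> j
  proof -
    have "fock_coeff \<psi> (component j w) = Rep_ell2 (component j (rmult \<psi>))"
      by (auto simp: Rep_component Rep_rmult)
    then show ?thesis by (simp add: ftimes_def Rep_ell2_inverse)
  qed
  show thesis
  proof (rule that[of u "\<lambda>j. component j w"])
    show "x j = u \<otimes> component j w" if "j \<in> J" for j
      using c[OF that] by (simp add: comp cu)
    show "Rep_ell2 (\<psi> \<otimes> component j w) h = fock_coeff \<psi> (component j w) h" for j \<psi> h
      by (simp add: comp Rep_component Rep_rmult)
    show "norm (\<psi> \<otimes> component j w) \<le> norm \<psi>" for j \<psi>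
      unfolding comp unfolding component_def
      by (rule order_trans[OF norm_pull_le[OF inj_component] norm_rmult_le])
  qed
qed

section \<open>Strong operator closure and reflexivity\<close>

lemma cyclic_subspace_in_Lat:
  assumes U: "subalgebra U"
  shows "closure ((\<lambda>B. blinfun_apply B u) ` U) \<in> Lat U"
proof -
  let ?S = "(\<lambda>B. blinfun_apply B u) ` U"
  have sub: "cop.subspace U" and prod: "\<And>A B. A \<in> U \<Longrightarrow> B \<in> U \<Longrightarrow> A o\<^sub>L B \<in> U"
    using U by (auto simp: subalgebra_def)
  have "cvec.subspace ?S"
  proof (rule cvec.subspaceI)
    show "0 \<in> ?S" using cop.subspace_0[OF sub] by (rule rev_image_eqI) simp
    show "x + y \<in> ?S" if "x \<in> ?S" "y \<in> ?S" for x y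
      using that cop.subspace_add[OF sub] unfolding image_iff by (metis blinfun.add_left)
    show "scaleC c x \<in> ?S" if "x \<in> ?S" for c x
      using that cop.subspace_scale[OF sub] unfolding image_iff by (metis scaleC_op_apply)
  qed
  then have "cvec.subspace (closure ?S)" by (rule subspace_closure)
  moreover have "blinfun_apply A ` closure ?S \<subseteq> closure ?S" if A: "A \<in> U" for A
  proof -
    have "blinfun_apply A ` closure ?S \<subseteq> closure (blinfun_apply A ` ?S)"
      by (rule closure_bounded_linear_image_subset[OF blinfun.bounded_linear_right])
    also have "\<dots> \<subseteq> closure ?S"
    proof (rule closure_mono, clarify)
      fix B assume "B \<in> U"
      show "blinfun_apply A (blinfun_apply B u) \<in> ?S"
        by (rule rev_image_eqI[OF prod[OF A \<open>B \<in> U\<close>]]) simp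
    qed
    finally show ?thesis .
  qed
  ultimately show ?thesis by (auto simp: Lat_def Lat_op_def)
qed

lemma sot_closed_approximation:
  assumes U: "sot_closed U" and A: "A \<in> bounded_ops"
    and approx: "\<And>X e. finite X \<Longrightarrow> 0 < e \<Longrightarrow>
      \<exists>B\<in>U. \<forall>x\<in>X. norm (blinfun_apply B x - blinfun_apply A x) < e"
  shows "A \<in> U"
proof (rule ccontr)
  assume "A \<notin> U"
  have top: "topspace (subtopology strong_operator_topology bounded_ops) = bounded_ops"
    by (simp add: strong_operator_topology_topspace)
  have "U \<subseteq> bounded_ops"
    using closedin_subset[OF U[unfolded sot_closed_def]] unfolding top .
  have "openin (subtopology strong_operator_topology bounded_ops) (bounded_ops - U)"
    using U unfolding sot_closed_def closedin_def top by blast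
  then obtain T where T: "openin strong_operator_topology T" "bounded_ops - U = T \<inter> bounded_ops"
    unfolding openin_subtopology by blast
  then obtain W where W: "open W" "T = blinfun_apply -` W"
    unfolding strong_operator_topology_def openin_pullback_topology by auto
  have "blinfun_apply A \<in> W" using T(2) W(2) A \<open>A \<notin> U\<close> by blast
  moreover have "openin (product_topology (\<lambda>_. euclidean) UNIV) W"
    using W(1) unfolding open_fun_def .
  ultimately obtain Y where "blinfun_apply A \<in> (\<Pi>\<^sub>E x\<in>UNIV. Y x)" and "\<forall>x. openin euclidean (Y x)"
      and "finite {x. Y x \<noteq> topspace euclidean}" and YW: "(\<Pi>\<^sub>E x\<in>UNIV. Y x) \<subseteq> W"
    using product_topology_open_contains_basis[of "\<lambda>_. euclidean" UNIV W "blinfun_apply A"] by blast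
  then have Y: "\<And>x. blinfun_apply A x \<in> Y x" "\<And>x. open (Y x)" "finite {x. Y x \<noteq> UNIV}"
    by (simp_all add: PiE_iff)
  define X where "X = {x. Y x \<noteq> UNIV}"
  have "\<exists>e>0. ball (blinfun_apply A x) e \<subseteq> Y x" for x
    using Y(1,2)[of x] open_contains_ball by blast
  then obtain e where e: "\<And>x. e x > 0" "\<And>x. ball (blinfun_apply A x) (e x) \<subseteq> Y x" by metis
  have X: "finite X" using Y(3) by (simp add: X_def)
  define d where "d = Min (insert 1 (e ` X))"
  have d: "0 < d" "\<And>x. x \<in> X \<Longrightarrow> d \<le> e x" using X e(1) by (auto simp: d_def)
  obtain B where B: "B \<in> U" "\<And>x. x \<in> X \<Longrightarrow> norm (blinfun_apply B x - blinfun_apply A x) < d"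
    using approx[OF X d(1)] by blast
  have "blinfun_apply B x \<in> Y x" for x
  proof (cases "x \<in> X")
    case True
    then have "blinfun_apply B x \<in> ball (blinfun_apply A x) (e x)"
      using B(2)[OF True] d(2)[OF True] by (simp add: dist_norm norm_minus_commute)
    then show ?thesis using e(2) by blast
  qed (simp add: X_def)
  then have "blinfun_apply B \<in> W" using subsetD[OF YW, of "blinfun_apply B"] by (simp add: PiE_iff)
  then have "B \<in> T \<inter> bounded_ops" using B(1) W(2) \<open>U \<subseteq> bounded_ops\<close> by blast
  then show False using B(1) unfolding T(2)[symmetric] by blast
qed

lemma ftimes_assoc:
  assumes \<phi>: "\<phi> \<in> F_inf" and w: "\<And>\<psi> h. Rep_ell2 (\<psi> \<otimes> w) h = fock_coeff \<psi> w h"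
  shows "\<phi> \<otimes> (u \<otimes> w) = (\<phi> \<otimes> u) \<otimes> w"
  by (rule ell2_eqI) (simp add: w Rep_ftimes[OF disjI1[OF \<phi>]] fock_coeff_assoc[of "\<phi> \<otimes> u" \<phi> u "u \<otimes> w" w])

theorem theorem4p2:
  fixes U :: "('n::finite fock \<Rightarrow>\<^sub>L 'n fock) set"
  assumes "subalgebra U"
    and "U \<subseteq> fock_op ` F_inf"
    and "sot_closed U"
    and "id_blinfun \<in> U"
  shows "reflexive U"
proof -
  have "U \<subseteq> Alg (Lat U)"
    using assms(1) by (auto simp: Alg_def Lat_def subalgebra_def)
  moreover have "A \<in> U" if A: "A \<in> Alg (Lat U)" for A
  proof (rule sot_closed_approximation[OF assms(3)])
    show "A \<in> bounded_ops" using A by (simp add: Alg_def)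
    have "Lat (fock_op ` F_inf) \<subseteq> Lat U" using assms(2) by (auto simp: Lat_def)
    then have "A \<in> Alg (Lat (fock_op ` F_inf))" using A by (auto simp: Alg_def)
    then obtain \<phi> where \<phi>: "\<phi> \<in> F_inf" and A_eq: "A = fock_op \<phi>" using Alg_Lat_F_inf by blast
    fix X :: "'n fock set" and e :: real
    assume "finite X" "0 < e"
    \<comment> \<open>Indexing the family \<open>X\<close> by its own elements avoids an enumeration.\<close>
    then obtain u w where x: "\<And>x. x \<in> X \<Longrightarrow> x = u \<otimes> w x"
      and w: "\<And>x \<psi> h. Rep_ell2 (\<psi> \<otimes> w x) h = fock_coeff \<psi> (w x) h"
      and w_le: "\<And>x \<psi>. norm (\<psi> \<otimes> w x) \<le> norm \<psi>"
      using common_left_factor[of X "\<lambda>x. x"] by blast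
    let ?S = "(\<lambda>B. blinfun_apply B u) ` U"
    have "u \<in> closure ?S"
      by (rule subsetD[OF closure_subset], rule rev_image_eqI[OF assms(4)]) simp
    moreover have "closure ?S \<in> Lat_op A"
      using cyclic_subspace_in_Lat[OF assms(1)] A by (auto simp: Alg_def)
    ultimately have "blinfun_apply A u \<in> closure ?S" by (auto simp: Lat_op_def)
    then obtain B where B: "B \<in> U" and close: "norm (blinfun_apply B u - blinfun_apply A u) < e"
      using \<open>0 < e\<close> unfolding closure_approachable by (auto simp: dist_norm)
    obtain \<beta> where \<beta>: "\<beta> \<in> F_inf" and B_eq: "B = fock_op \<beta>" using B assms(2) by blast
    have "norm (blinfun_apply B x - blinfun_apply A x) < e" if "x \<in> X" for x
    proof -
      have "\<eta> \<otimes> x = (\<eta> \<otimes> u) \<otimes> w x" if "\<eta> \<in> F_inf" for \<eta>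
        using ftimes_assoc[OF that w, of u x] unfolding x[OF \<open>x \<in> X\<close>, symmetric] .
      then have "blinfun_apply B x - blinfun_apply A x = (\<beta> \<otimes> u) \<otimes> w x - (\<phi> \<otimes> u) \<otimes> w x"
        by (simp add: B_eq A_eq fock_op_apply \<phi> \<beta>)
      also have "\<dots> = (\<beta> \<otimes> u - \<phi> \<otimes> u) \<otimes> w x"
        by (rule ell2_eqI) (simp add: Rep_ell2_diff w fock_coeff_diff_left)
      finally show ?thesis
        using w_le[of "\<beta> \<otimes> u - \<phi> \<otimes> u" x] close by (simp add: B_eq A_eq fock_op_apply \<phi> \<beta>)
    qed
    with B show "\<exists>B\<in>U. \<forall>x\<in>X. norm (blinfun_apply B x - blinfun_apply A x) < e" by blast
  qed
  ultimately show ?thesis by (auto simp: reflexive_def)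
qed

end
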